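(* Let $k$ be a (not necessarily commutative) field, with multiplicative group $k^\times$. Then $H_1(k)\cong (k^\times)_{\mathrm{ab}}/\{\pm1\}$, where $(k^\times)_{\mathrm{ab}}$ is the abelianization of $k^\times$ and $\{\pm 1\}$ stands for the image of $\{\pm1\}\subseteq k^\times$ in $(k^\times)_{\mathrm{ab}}$.
   Context: A not necessarily commutative field is a division ring. For a ring $R$ and $n\ge1$, $L'_n(R)$ is the collection of pairs $(B\,|\,A)$ of matrices over $R$ such that $A$ has $n$ columns and $B$ has the same number of rows as $A$ (the number of rows, and the number of columns of $B$, are arbitrary). $(B\,|\,A)\le_n(B'\,|\,A')$ holds if there are matrices $U,V,G$ over $R$, of appropriate size, with $UB=B'V$ and $UA=A'+B'G$; this is a pre-order, and $\approx_n$ is the associated equivalence relation. $L_n(R)$ is the set of $\approx_n$-classes $[B\,|\,A]$. For $n\ge 1$ and $[B\,|\,A]\in L_{n+1}(R)$ with columns indexed $A=(A_0,\dots,A_n)$, let $\hat A_i$ be $A$ with column $A_i$ removed and put $E_i[B\,|\,A]=[B,A_i\,|\,\hat A_i]$, $N_i[B\,|\,A]=[B\,|\,\hat A_i]$ in $L_n(R)$ (these are well defined). The complex $Q_*(R)$ has $Q_n(R)$ the free abelian group on $L_{n+1}(R)$ for $n\ge0$, $Q_{-1}(R)=\mathbb Z$, and $Q_n(R)=0$ for $n<-1$; the boundary is $\partial_n=\sum_{i=0}^n(-1)^i(E_i-N_i)$ for $n>0$, $\partial_0:Q_0(R)\to\mathbb Z$ sends each generator to $1$, and $\partial_n=0$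 for $n\le-1$. For $n>0$, $[B\,|\,A]\in L_{n+1}(R)$ is degenerate if $E_i[B\,|\,A]=N_i[B\,|\,A]$ for some $0\le i\le n$; $M_n(R)\subseteq Q_n(R)$ is the subgroup generated by degenerate elements for $n>0$, and $M_n(R)=0$ for $n\le0$. $M_*(R)$ is a subcomplex, $C_*(R)=Q_*(R)/M_*(R)$, and $H_n(R)$ is the homology of $C_*(R)$ at $C_n(R)$. *)

theory Defs
  imports
    "Jordan_Normal_Form.Matrix"
    "HOL-Algebra.Free_Abelian_Groups"
    "HOL-Algebra.Elementary_Groups"
    "HOL-Algebra.Generated_Groups"
begin

section \<open>The pre-ordered sets of matrix pairs\<close>

text \<open>A pair \<open>(B, A)\<close> stands for \<open>(B | A)\<close>. Matrices with no rows or no columns are allowed.\<close>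

type_synonym 'a mpair = "'a mat \<times> 'a mat"
type_synonym 'a mclass = "'a mpair set"

definition mpairs :: "nat \<Rightarrow> 'a mpair set" where
  "mpairs n = {(B, A). dim_col A = n \<and> dim_row B = dim_row A}"

definition mle :: "nat \<Rightarrow> ('a::ring_1 mpair \<times> 'a mpair) set" where
  "mle n = {((B, A), (B', A')). (B, A) \<in> mpairs n \<and> (B', A') \<in> mpairs n \<and>
     (\<exists>U V G. U \<in> carrier_mat (dim_row B') (dim_row B) \<and>
              V \<in> carrier_mat (dim_col B') (dim_col B) \<and>
              G \<in> carrier_mat (dim_col B') n \<and>
              U * B = B' * V \<and> U * A = A' + B' * G)}"

definition meq :: "nat \<Rightarrow> ('a::ring_1 mpair \<times> 'a mpair) set" where
  "meq n = mle n \<inter> (mle n)\<inverse>"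

definition Lset :: "nat \<Rightarrow> 'a::ring_1 mclass set" where
  "Lset n = mpairs n // meq n"

lemma mleI:
  assumes "(B, A) \<in> mpairs n" "(B', A') \<in> mpairs n"
    "U \<in> carrier_mat (dim_row B') (dim_row B)" "V \<in> carrier_mat (dim_col B') (dim_col B)"
    "G \<in> carrier_mat (dim_col B') n" "U * B = B' * V" "U * A = A' + B' * G"
  shows "((B, A), (B', A')) \<in> mle n"
  using assms unfolding mle_def by blast

lemma mle_refl: "refl_on (mpairs n) (mle n)"
proof (rule refl_onI)
  fix x :: "'a mpair" assume x: "x \<in> mpairs n"
  obtain B A where xBA: "x = (B, A)" by force
  have d: "dim_col A = n" "dim_row B = dim_row A" using x by (auto simp: xBA mpairs_def)
  have "1\<^sub>m (dim_row B) * B = B * 1\<^sub>m (dim_col B)"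
    by (metis carrier_matI left_mult_one_mat right_mult_one_mat)
  moreover have "1\<^sub>m (dim_row B) * A = A + B * 0\<^sub>m (dim_col B) n"
    using d by (metis carrier_matI left_mult_one_mat right_add_zero_mat right_mult_zero_mat)
  ultimately have "\<exists>U V G. U \<in> carrier_mat (dim_row B) (dim_row B) \<and>
      V \<in> carrier_mat (dim_col B) (dim_col B) \<and> G \<in> carrier_mat (dim_col B) n \<and>
      U * B = B * V \<and> U * A = A + B * G"
    by (meson one_carrier_mat zero_carrier_mat)
  then show "(x, x) \<in> mle n"
    using x unfolding xBA mle_def by simp
qed

lemma mle_trans: "trans (mle n :: ('a::ring_1 mpair \<times> 'a mpair) set)"
proof (rule transI)
  fix x y z :: "'a mpair" assume xy: "(x, y) \<in> mle n" and yz: "(y, z) \<in> mle n"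
  obtain B A B' A' B'' A'' where e: "x = (B, A)" "y = (B', A')" "z = (B'', A'')" by force
  define p q where pq: "p = dim_row B" "q = dim_col B"
  define p' q' where pq': "p' = dim_row B'" "q' = dim_col B'"
  define p'' q'' where pq'': "p'' = dim_row B''" "q'' = dim_col B''"
  obtain U V G where 1: "U \<in> carrier_mat p' p" "V \<in> carrier_mat q' q" "G \<in> carrier_mat q' n"
      "U * B = B' * V" "U * A = A' + B' * G"
    using xy unfolding e mle_def pq pq' pq'' by auto
  obtain U' V' G' where 2: "U' \<in> carrier_mat p'' p'" "V' \<in> carrier_mat q'' q'"
      "G' \<in> carrier_mat q'' n" "U' * B' = B'' * V'" "U' * A' = A'' + B'' * G'"
    using yz unfolding e mle_def pq pq' pq'' by auto
  have c: "B \<in> carrier_mat p q" "A \<in> carrier_mat p n" "B' \<in> carrier_mat p' q'"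
      "A' \<in> carrier_mat p' n" "B'' \<in> carrier_mat p'' q''" "A'' \<in> carrier_mat p'' n"
    using xy yz unfolding e mle_def mpairs_def pq pq' pq'' by auto
  have "(U' * U) * B = U' * (B' * V)" using 1 2 c by (simp add: assoc_mult_mat)
  also have "\<dots> = (U' * B') * V" using 1 2 c by (intro assoc_mult_mat[symmetric]) auto
  also have "\<dots> = B'' * (V' * V)" unfolding 2(4) using 1 2 c by (intro assoc_mult_mat) auto
  finally have r1: "(U' * U) * B = B'' * (V' * V)" .
  have "(U' * U) * A = U' * (A' + B' * G)" using 1 2 c by (simp add: assoc_mult_mat)
  also have "\<dots> = U' * A' + U' * (B' * G)"
    using 1 2 c by (intro mult_add_distrib_mat) auto
  also have "U' * (B' * G) = (U' * B') * G" using 1 2 c by (intro assoc_mult_mat[symmetric]) auto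
  also have "\<dots> = B'' * (V' * G)" unfolding 2(4) using 1 2 c by (intro assoc_mult_mat) auto
  also have "U' * A' + B'' * (V' * G) = A'' + (B'' * G' + B'' * (V' * G))"
    unfolding 2(5) using 1 2 c by (intro assoc_add_mat) auto
  also have "B'' * G' + B'' * (V' * G) = B'' * (G' + V' * G)"
    using 1 2 c by (intro mult_add_distrib_mat[symmetric]) auto
  finally have r2: "(U' * U) * A = A'' + B'' * (G' + V' * G)" .
  show "(x, z) \<in> mle n"
    unfolding e
  proof (rule mleI[OF _ _ _ _ _ r1 r2])
    show "(B, A) \<in> mpairs n" "(B'', A'') \<in> mpairs n"
      using xy yz unfolding e mle_def by auto
  qed (use 1 2 in \<open>auto simp: pq pq' pq''\<close>)
qed

lemma equiv_meq: "equiv (mpairs n) (meq n)"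
proof (rule equivI)
  show "meq n \<subseteq> mpairs n \<times> mpairs n" by (auto simp: meq_def mle_def)
  show "refl_on (mpairs n) (meq n)"
    using mle_refl[of n] by (auto simp: meq_def refl_on_def)
  show "sym (meq n)" by (auto simp: meq_def sym_def)
  show "trans (meq n)"
    unfolding meq_def by (intro trans_Int mle_trans) (use mle_trans[of n] in \<open>unfold trans_def, blast\<close>)
qed


section \<open>Face operations\<close>

definition del_col :: "nat \<Rightarrow> 'a mat \<Rightarrow> 'a mat" where
  "del_col i A = mat (dim_row A) (dim_col A - 1) (\<lambda>(r, c). A $$ (r, if c < i then c else Suc c))"

definition snoc_col :: "'a mat \<Rightarrow> 'a vec \<Rightarrow> 'a mat" where
  "snoc_col B v = mat (dim_row B) (Suc (dim_col B))
     (\<lambda>(r, c). if c < dim_col B then B $$ (r, c) else v $ r)"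

definition E_rep :: "nat \<Rightarrow> 'a mpair \<Rightarrow> 'a mpair" where
  "E_rep i = (\<lambda>(B, A). (snoc_col B (col A i), del_col i A))"

definition N_rep :: "nat \<Rightarrow> 'a mpair \<Rightarrow> 'a mpair" where
  "N_rep i = (\<lambda>(B, A). (B, del_col i A))"

text \<open>The maps on classes, from \<open>Lset (Suc n)\<close> to \<open>Lset n\<close>. The union ranges over all
  representatives; it is a single class by \<open>E_class\<close> and \<open>N_class\<close> below.\<close>

definition face_E :: "nat \<Rightarrow> nat \<Rightarrow> 'a::ring_1 mclass \<Rightarrow> 'a mclass" where
  "face_E n i X = (\<Union>x\<in>X. meq n `` {E_rep i x})"

definition face_N :: "nat \<Rightarrow> nat \<Rightarrow> 'a::ring_1 mclass \<Rightarrow> 'a mclass" where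
  "face_N n i X = (\<Union>x\<in>X. meq n `` {N_rep i x})"

lemma del_col_carrier: "A \<in> carrier_mat m (Suc n) \<Longrightarrow> del_col i A \<in> carrier_mat m n"
  by (auto simp: del_col_def)

lemma snoc_col_carrier: "B \<in> carrier_mat m p \<Longrightarrow> snoc_col B v \<in> carrier_mat m (Suc p)"
  by (auto simp: snoc_col_def)

lemma row_del_col_prod:
  assumes "A \<in> carrier_mat m (Suc n)" "U \<in> carrier_mat k m" "i \<le> n"
  shows "U * del_col i A = del_col i (U * A)"
  using assms by (intro eq_matI) (auto simp: del_col_def scalar_prod_def)

lemma del_col_add:
  assumes "A \<in> carrier_mat m (Suc n)" "A' \<in> carrier_mat m (Suc n)" "i \<le> n"
  shows "del_col i (A + A') = del_col i A + del_col i A'"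
  using assms by (intro eq_matI) (auto simp: del_col_def)

lemma N_mono:
  assumes "(x, y) \<in> mle (Suc n)" "i \<le> n"
  shows "(N_rep i x, N_rep i y) \<in> mle n"
proof -
  obtain B A B' A' where e: "x = (B, A)" "y = (B', A')" by force
  define p q where pq: "p = dim_row B" "q = dim_col B"
  define p' q' where pq': "p' = dim_row B'" "q' = dim_col B'"
  obtain U V G where 1: "U \<in> carrier_mat p' p" "V \<in> carrier_mat q' q" "G \<in> carrier_mat q' (Suc n)"
      "U * B = B' * V" "U * A = A' + B' * G"
    using assms unfolding e mle_def pq pq' by auto
  have c: "B \<in> carrier_mat p q" "A \<in> carrier_mat p (Suc n)" "B' \<in> carrier_mat p' q'"
      "A' \<in> carrier_mat p' (Suc n)"
    using assms unfolding e mle_def mpairs_def pq pq' by auto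
  have BG: "B' * G \<in> carrier_mat p' (Suc n)" using c 1 by simp
  have "U * del_col i A = del_col i A' + B' * del_col i G"
    using 1 c assms(2)
    by (simp add: row_del_col_prod[OF c(2) 1(1)] row_del_col_prod[OF 1(3) c(3)]
        del_col_add[OF c(4) BG])
  moreover have "(B, del_col i A) \<in> mpairs n" "(B', del_col i A') \<in> mpairs n"
    using c by (auto simp: mpairs_def del_col_def)
  ultimately show ?thesis
    using 1 del_col_carrier[OF 1(3)] unfolding e mle_def N_rep_def pq pq' by auto
qed

lemma E_mono:
  assumes "(x, y) \<in> mle (Suc n)" "i \<le> n"
  shows "(E_rep i x, E_rep i y) \<in> mle n"
proof -
  obtain B A B' A' where e: "x = (B, A)" "y = (B', A')" by force
  define p q where pq: "p = dim_row B" "q = dim_col B"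
  define p' q' where pq': "p' = dim_row B'" "q' = dim_col B'"
  obtain U V G where 1: "U \<in> carrier_mat p' p" "V \<in> carrier_mat q' q" "G \<in> carrier_mat q' (Suc n)"
      "U * B = B' * V" "U * A = A' + B' * G"
    using assms unfolding e mle_def pq pq' by auto
  have c: "B \<in> carrier_mat p q" "A \<in> carrier_mat p (Suc n)" "B' \<in> carrier_mat p' q'"
      "A' \<in> carrier_mat p' (Suc n)"
    using assms unfolding e mle_def mpairs_def pq pq' by auto
  define V' where "V' = mat (Suc q') (Suc q)
    (\<lambda>(r, s). if s < q then (if r < q' then V $$ (r, s) else 0)
              else if r < q' then G $$ (r, i) else 1)"
  define G' where "G' = mat (Suc q') n (\<lambda>(r, s). if r < q' then del_col i G $$ (r, s) else 0)"
  have UB: "(U * B) $$ (r, s) = (B' * V) $$ (r, s)" for r s using 1 by simp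
  have UA: "(U * A) $$ (r, s) = (A' + B' * G) $$ (r, s)" for r s using 1 by simp
  have V: "U * snoc_col B (col A i) = snoc_col B' (col A' i) * V'"
  proof (rule eq_matI)
    fix r s assume "r < dim_row (snoc_col B' (col A' i) * V')"
      "s < dim_col (snoc_col B' (col A' i) * V')"
    then have rs: "r < p'" "s < Suc q" using c by (auto simp: snoc_col_def V'_def)
    show "(U * snoc_col B (col A i)) $$ (r, s) = (snoc_col B' (col A' i) * V') $$ (r, s)"
    proof (cases "s < q")
      case True
      then show ?thesis using rs c 1(1,2) UB[of r s]
        by (simp add: snoc_col_def V'_def scalar_prod_def)
    next
      case False
      then show ?thesis using rs c 1(1,3) UA[of r i] assms(2)
        by (simp add: snoc_col_def V'_def scalar_prod_def add.commute)
    qed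
  qed (use c 1 in \<open>auto simp: snoc_col_def V'_def\<close>)
  have BG: "B' * G \<in> carrier_mat p' (Suc n)" using c 1 by simp
  have "U * del_col i A = del_col i A' + B' * del_col i G"
    using 1 c assms(2)
    by (simp add: row_del_col_prod[OF c(2) 1(1)] row_del_col_prod[OF 1(3) c(3)]
        del_col_add[OF c(4) BG])
  moreover have "B' * del_col i G = snoc_col B' (col A' i) * G'"
    using c del_col_carrier[OF 1(3), of i]
    by (intro eq_matI) (auto simp: snoc_col_def G'_def scalar_prod_def)
  ultimately have G: "U * del_col i A = del_col i A' + snoc_col B' (col A' i) * G'"
    by simp
  have "V' \<in> carrier_mat (Suc q') (Suc q)" "G' \<in> carrier_mat (Suc q') n"
    by (auto simp: V'_def G'_def)
  moreover have "snoc_col B (col A i) \<in> carrier_mat p (Suc q)"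
    "snoc_col B' (col A' i) \<in> carrier_mat p' (Suc q')"
    "del_col i A \<in> carrier_mat p n" "del_col i A' \<in> carrier_mat p' n"
    using c by (auto intro: snoc_col_carrier del_col_carrier)
  ultimately show ?thesis
    using 1(1) V G unfolding e mle_def E_rep_def mpairs_def by auto
qed

lemma E_class:
  assumes "x \<in> mpairs (Suc n)" "i \<le> n"
  shows "face_E n i (meq (Suc n) `` {x}) = meq n `` {E_rep i x}"
  unfolding face_E_def
proof (rule UN_equiv_class[OF equiv_meq _ assms(1)])
  show "(\<lambda>x. meq n `` {E_rep i x}) respects meq (Suc n)"
    using assms(2) by (intro congruentI equiv_class_eq[OF equiv_meq]) (auto simp: meq_def E_mono)
qed

lemma N_class:
  assumes "x \<in> mpairs (Suc n)" "i \<le> n"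
  shows "face_N n i (meq (Suc n) `` {x}) = meq n `` {N_rep i x}"
  unfolding face_N_def
proof (rule UN_equiv_class[OF equiv_meq _ assms(1)])
  show "(\<lambda>x. meq n `` {N_rep i x}) respects meq (Suc n)"
    using assms(2) by (intro congruentI equiv_class_eq[OF equiv_meq]) (auto simp: meq_def N_mono)
qed


section \<open>The complexes and their homology\<close>

type_synonym 'a chain = "'a mclass \<Rightarrow>\<^sub>0 int"

text \<open>To keep all degrees in one type, the group of integers in degree \<open>-1\<close> is realised as the
  free abelian group on the single formal generator \<open>{}\<close>.\<close>

definition Q_grp :: "int \<Rightarrow> 'a::ring_1 chain monoid" where
  "Q_grp n = free_Abelian_group (if n \<ge> 0 then Lset (nat n + 1) else if n = -1 then {{}} else {})"

lemma Q_minus_one: "integer_group \<cong> (Q_grp (-1) :: 'a::ring_1 chain monoid)"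
  using isomorphic_group_integer_free_Abelian_group_singleton[of "{} :: 'a mclass"]
  by (simp add: Q_grp_def)

definition bd_Q :: "int \<Rightarrow> 'a::ring_1 chain \<Rightarrow> 'a chain" where
  "bd_Q n = (if n > 0 then frag_extend (\<lambda>X. \<Sum>i\<le>nat n.
              frag_cmul ((-1) ^ i) (frag_of (face_E (nat n) i X) - frag_of (face_N (nat n) i X)))
           else if n = 0 then frag_extend (\<lambda>X. frag_of {})
           else (\<lambda>c. 0))"

definition degenerate :: "nat \<Rightarrow> 'a::ring_1 mclass \<Rightarrow> bool" where
  "degenerate n X \<longleftrightarrow> X \<in> Lset (n + 1) \<and> (\<exists>i\<le>n. face_E n i X = face_N n i X)"

definition M_sub :: "int \<Rightarrow> 'a::ring_1 chain set" where
  "M_sub n = generate (Q_grp n) (if n > 0 then frag_of ` {X. degenerate (nat n) X} else {})"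

definition C_grp :: "int \<Rightarrow> 'a::ring_1 chain set monoid" where
  "C_grp n = Q_grp n Mod M_sub n"

definition bd_C :: "int \<Rightarrow> 'a::ring_1 chain set \<Rightarrow> 'a chain set" where
  "bd_C n X = (\<Union>c\<in>X. M_sub (n - 1) #>\<^bsub>Q_grp (n - 1)\<^esub> bd_Q n c)"

definition H_grp :: "int \<Rightarrow> 'a::ring_1 chain set set monoid" where
  "H_grp n = (C_grp n)\<lparr>carrier := kernel (C_grp n) (C_grp (n - 1)) (bd_C n)\<rparr>
           Mod (bd_C (n + 1) ` carrier (C_grp (n + 1)))"


section \<open>The abelianized multiplicative group\<close>

definition mult_group :: "'k::division_ring monoid" where
  "mult_group = \<lparr>carrier = UNIV - {0}, monoid.mult = (*), one = 1\<rparr>"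

definition abelianization :: "'g monoid \<Rightarrow> 'g set monoid" where
  "abelianization G = G Mod derived G (carrier G)"

definition ab_class :: "'g monoid \<Rightarrow> 'g \<Rightarrow> 'g set" where
  "ab_class G x = derived G (carrier G) #>\<^bsub>G\<^esub> x"

end

theory Submission
  imports Defs
begin

text \<open>
Solving \<open>B y = A x\<close> turns a pair \<open>(B | A)\<close> with \<open>n\<close> columns in \<open>A\<close> into a set of vectors
\<open>x \<in> k\<^sup>n\<close>, closed under differences and under scaling on the right. Over a division ring this set
determines the class of the pair (lemma \<open>mle_iff_sol\<close>), because every matrix has a generalized
inverse (lemma \<open>regular_mat\<close>). So \<open>L\<^sub>n(k)\<close> is the set of right subspaces of \<open>k\<^sup>n\<close>. The face \<open>N\<^sub>i\<close>
intersects a subspace with the hyperplane \<open>x\<^sub>i = 0\<close>, the face \<open>E\<^sub>i\<close> projects it along the \<open>i\<close>-th axis,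
and degeneracy means that the subspace splits along some axis.

In \<open>k\<^sup>2\<close> the subspaces that are not degenerate are the lines \<open>x\<^sub>1 = a x\<^sub>0\<close> with \<open>a \<noteq> 0\<close>. Each of them
projects onto both axes and meets both only in the origin, so \<open>\<partial>\<^sub>1 = 0\<close> and \<open>H\<^sub>1(k)\<close> is the quotient of
the free abelian group on the symbols \<open>[a]\<close>, \<open>a \<in> k\<^sup>\<times>\<close>, by the image of \<open>\<partial>\<^sub>2\<close>. In \<open>k\<^sup>3\<close> there are
two kinds of subspaces that are not degenerate (lemma \<open>space_cases\<close>):

 \<^item> lines through \<open>(1, a, c a)\<close> with \<open>a\<close>, \<open>c\<close> nonzero, with boundary \<open>[c] - [c a] + [a]\<close>;
 \<^item> planes \<open>x\<^sub>2 = c (x\<^sub>1 - a x\<^sub>0)\<close> with \<open>a\<close>, \<open>c\<close> nonzero, with boundary \<open>- [c] + [- c a] - [a]\<close>.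

The lines make \<open>a \<mapsto> [a]\<close> a homomorphism from \<open>k\<^sup>\<times>\<close> to an abelian group, and then the planes say
exactly that \<open>[-1]\<close> vanishes. The isomorphism is obtained from two mutually inverse homomorphisms:
one sends \<open>[a]\<close> to the class of \<open>a\<close> and comes from the universal property of \<open>H\<^sub>1(k)\<close> (lemma
\<open>H_grp_1_universal\<close>), the other sends the class of \<open>a\<close> to \<open>[a]\<close> and comes from that of the
abelianized unit group modulo sign (lemma \<open>units_universal\<close>).
\<close>

section \<open>Matrices over a division ring are von Neumann regular\<close>

text \<open>The induction step for generalized inverses. Let \<open>P = 1 - B\<^sub>0 X\<close>, which annihilates \<open>B\<^sub>0\<close>. If
\<open>P b = 0\<close>, the column \<open>b\<close> already lies in the column space of \<open>B\<^sub>0\<close>. Otherwise some entry of \<open>P b\<close>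
is a unit, and scaling the corresponding row of \<open>P\<close> gives a functional \<open>f\<close> with \<open>f B\<^sub>0 = 0\<close> and
\<open>f b = 1\<close>. In both cases \<open>B\<^sub>0 X + P b f\<close> fixes \<open>B\<^sub>0\<close> and \<open>b\<close>, and it has the shape
\<open>B\<^sub>0 Z + b f\<close> required of a product with the block matrix \<open>(B\<^sub>0 | b)\<close> on the left.\<close>

lemma regular_mat_snoc_col:
  fixes B\<^sub>0 b X :: "'a::division_ring mat"
  assumes c: "B\<^sub>0 \<in> carrier_mat p q" "b \<in> carrier_mat p 1" "X \<in> carrier_mat q p"
    and X: "B\<^sub>0 * X * B\<^sub>0 = B\<^sub>0"
  shows "\<exists>Z f. Z \<in> carrier_mat q p \<and> f \<in> carrier_mat 1 p \<and>
    (B\<^sub>0 * Z + b * f) * B\<^sub>0 = B\<^sub>0 \<and> (B\<^sub>0 * Z + b * f) * b = b"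
proof -
  define P where "P = 1\<^sub>m p - B\<^sub>0 * X"
  have P: "P \<in> carrier_mat p p" using c by (auto simp: P_def)
  have PB: "P * B\<^sub>0 = 0\<^sub>m p q"
  proof -
    have "P * B\<^sub>0 = 1\<^sub>m p * B\<^sub>0 - B\<^sub>0 * X * B\<^sub>0"
      unfolding P_def using c by (intro minus_mult_distrib_mat) auto
    then show ?thesis using c X by simp
  qed
  obtain f where f: "f \<in> carrier_mat 1 p" "f * B\<^sub>0 = 0\<^sub>m 1 q" "P * b * (f * b) = P * b"
  proof (cases "\<exists>r<p. (P * b) $$ (r, 0) \<noteq> 0")
    case False
    then have "P * b = 0\<^sub>m p 1" using P c by (intro eq_matI) auto
    then show ?thesis using c by (intro that[of "0\<^sub>m 1 p"]) auto
  next
    case True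
    then obtain r where r: "r < p" "(P * b) $$ (r, 0) \<noteq> 0" by blast
    define s where "s = inverse ((P * b) $$ (r, 0))"
    define g where "g = mat 1 p (\<lambda>(i, j). if j = r then s else 0)"
    have g: "g \<in> carrier_mat 1 p" by (simp add: g_def)
    have gM: "(g * M) $$ (0, j) = s * M $$ (r, j)" if "M \<in> carrier_mat p m" "j < m" for M j m
    proof -
      have "(g * M) $$ (0, j) = (\<Sum>i = 0..<p. g $$ (0, i) * M $$ (i, j))"
        using that g by (simp add: scalar_prod_def)
      also have "\<dots> = (\<Sum>i = 0..<p. if i = r then s * M $$ (i, j) else 0)"
        by (intro sum.cong) (auto simp: g_def)
      finally show ?thesis using r by simp
    qed
    have "g * (P * b) = 1\<^sub>m 1"
      using gM[of "P * b" 1 0] P c r(2) g by (intro eq_matI) (auto simp: s_def)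
    moreover have "(g * P) * B\<^sub>0 = 0\<^sub>m 1 q"
      using g P c PB by simp
    ultimately show ?thesis using g P c by (intro that[of "g * P"]) auto
  qed
  define Z where "Z = X - X * b * f"
  have Z: "Z \<in> carrier_mat q p" using c f by (auto simp: Z_def)
  have M: "B\<^sub>0 * Z + b * f = B\<^sub>0 * X + P * b * f"
  proof -
    have e1: "B\<^sub>0 * Z = B\<^sub>0 * X - B\<^sub>0 * (X * b) * f"
      using c f assoc_mult_mat[of B\<^sub>0 p q "X * b" 1 f p] unfolding Z_def
      by (subst mult_minus_distrib_mat) auto
    have e2: "P * b * f = b * f - B\<^sub>0 * (X * b) * f"
    proof -
      have "P * b = 1\<^sub>m p * b - B\<^sub>0 * X * b"
        unfolding P_def using c by (intro minus_mult_distrib_mat) auto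
      then have "P * b = b - B\<^sub>0 * (X * b)" using c by simp
      moreover have "(b - B\<^sub>0 * (X * b)) * f = b * f - B\<^sub>0 * (X * b) * f"
        using c f by (intro minus_mult_distrib_mat) auto
      ultimately show ?thesis by simp
    qed
    have "S - T + R = S + (R - T)"
      if "S \<in> carrier_mat p p" "T \<in> carrier_mat p p" "R \<in> carrier_mat p p" for S T R :: "'a mat"
      using that by (intro eq_matI) auto
    then show ?thesis
      unfolding e1 e2 by this (use c f in auto)
  qed
  have "(B\<^sub>0 * X + P * b * f) * B\<^sub>0 = B\<^sub>0 * X * B\<^sub>0 + P * b * f * B\<^sub>0"
    using c f P by (intro add_mult_distrib_mat) auto
  also have "P * b * f * B\<^sub>0 = P * b * (f * B\<^sub>0)"
    using c f P by (intro assoc_mult_mat) auto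
  also have "B\<^sub>0 * X * B\<^sub>0 + P * b * (f * B\<^sub>0) = B\<^sub>0"
    using c P by (simp add: f X)
  finally have 1: "(B\<^sub>0 * X + P * b * f) * B\<^sub>0 = B\<^sub>0" .
  have "(B\<^sub>0 * X + P * b * f) * b = B\<^sub>0 * X * b + P * b * f * b"
    using c f P by (intro add_mult_distrib_mat) auto
  also have "P * b * f * b = P * b * (f * b)"
    using c f P by (intro assoc_mult_mat) auto
  also have "\<dots> = 1\<^sub>m p * b - B\<^sub>0 * X * b"
    unfolding f(3) unfolding P_def using c by (intro minus_mult_distrib_mat) auto
  also have "B\<^sub>0 * X * b + \<dots> = b"
    using c by (intro eq_matI) auto
  finally have 2: "(B\<^sub>0 * X + P * b * f) * b = b" .
  show ?thesis using Z f(1) 1 2 unfolding M[symmetric] by blast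
qed

lemma regular_mat:
  fixes B :: "'a::division_ring mat"
  assumes "B \<in> carrier_mat p q"
  shows "\<exists>X \<in> carrier_mat q p. B * X * B = B"
  using assms
proof (induction q arbitrary: B)
  case 0
  then show ?case by (intro bexI[of _ "0\<^sub>m 0 p"] eq_matI) auto
next
  case (Suc q)
  define B\<^sub>0 b where "B\<^sub>0 = mat p q (\<lambda>ij. B $$ ij)" and "b = mat p 1 (\<lambda>(i, j). B $$ (i, q))"
  have c: "B\<^sub>0 \<in> carrier_mat p q" "b \<in> carrier_mat p 1"
    by (auto simp: B\<^sub>0_def b_def)
  obtain X where X: "X \<in> carrier_mat q p" "B\<^sub>0 * X * B\<^sub>0 = B\<^sub>0"
    using Suc.IH[OF c(1)] by blast
  obtain Z f where Zf: "Z \<in> carrier_mat q p" "f \<in> carrier_mat 1 p"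
      and M: "(B\<^sub>0 * Z + b * f) * B\<^sub>0 = B\<^sub>0" "(B\<^sub>0 * Z + b * f) * b = b"
    using regular_mat_snoc_col[OF c X] by blast
  define Y where "Y = mat (Suc q) p (\<lambda>(i, j). if i < q then Z $$ (i, j) else f $$ (0, j))"
  have BY: "B * Y = B\<^sub>0 * Z + b * f"
    using Suc.prems Zf
    by (intro eq_matI) (auto simp: Y_def B\<^sub>0_def b_def scalar_prod_def)
  have "(B\<^sub>0 * Z + b * f) * B = B"
  proof (rule eq_matI)
    fix i j assume "i < dim_row B" "j < dim_col B"
    then have ij: "i < p" "j < Suc q" using Suc.prems by auto
    show "((B\<^sub>0 * Z + b * f) * B) $$ (i, j) = B $$ (i, j)"
    proof (cases "j < q")
      case True
      have "col B j = col B\<^sub>0 j" using True Suc.prems by (intro eq_vecI) (auto simp: B\<^sub>0_def)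
      then have "((B\<^sub>0 * Z + b * f) * B) $$ (i, j) = ((B\<^sub>0 * Z + b * f) * B\<^sub>0) $$ (i, j)"
        using ij True c Suc.prems by simp
      then show ?thesis unfolding M using ij True by (simp add: B\<^sub>0_def)
    next
      case False
      with ij have j: "j = q" by simp
      have "col B q = col b 0" using Suc.prems by (intro eq_vecI) (auto simp: b_def)
      then have "((B\<^sub>0 * Z + b * f) * B) $$ (i, j) = ((B\<^sub>0 * Z + b * f) * b) $$ (i, 0)"
        using ij j c Suc.prems by simp
      then show ?thesis unfolding M using ij j by (simp add: b_def)
    qed
  qed (use Suc.prems c in auto)
  with BY show ?case
    by (intro bexI[of _ Y]) (auto simp: Y_def)
qed

section \<open>Matrix pairs as subspaces\<close>

definition sol :: "'a::ring_1 mpair \<Rightarrow> (nat \<Rightarrow> 'a) set" where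
  "sol = (\<lambda>(B, A). {f. \<exists>y \<in> carrier_vec (dim_col B). A *\<^sub>v vec (dim_col A) f = B *\<^sub>v y})"

lemma sol_mono:
  assumes "(x, y) \<in> mle n"
  shows "sol x \<subseteq> sol y"
proof
  fix f assume f: "f \<in> sol x"
  obtain B A B' A' where e: "x = (B, A)" "y = (B', A')" by force
  define p q where pq: "p = dim_row B" "q = dim_col B"
  define p' q' where pq': "p' = dim_row B'" "q' = dim_col B'"
  obtain U V G where 1: "U \<in> carrier_mat p' p" "V \<in> carrier_mat q' q" "G \<in> carrier_mat q' n"
      "U * B = B' * V" "U * A = A' + B' * G"
    using assms unfolding e mle_def pq pq' by auto
  have c: "B \<in> carrier_mat p q" "A \<in> carrier_mat p n" "B' \<in> carrier_mat p' q'"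
      "A' \<in> carrier_mat p' n"
    using assms unfolding e mle_def mpairs_def pq pq' by auto
  let ?f = "vec n f"
  obtain z where z: "z \<in> carrier_vec q" "A *\<^sub>v ?f = B *\<^sub>v z"
    using f c by (auto simp: e sol_def)
  have "A' *\<^sub>v ?f + B' *\<^sub>v (G *\<^sub>v ?f) = (A' + B' * G) *\<^sub>v ?f"
    using c 1 by (subst add_mult_distrib_mat_vec) auto
  also have "\<dots> = U *\<^sub>v (A *\<^sub>v ?f)"
    unfolding 1(5)[symmetric] using c 1 by (intro assoc_mult_mat_vec) auto
  also have "\<dots> = (U * B) *\<^sub>v z"
    unfolding z using c 1 z by (intro assoc_mult_mat_vec[symmetric]) auto
  also have "\<dots> = B' *\<^sub>v (V *\<^sub>v z)"
    unfolding 1(4) using c 1 z by (intro assoc_mult_mat_vec) auto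
  finally have *: "A' *\<^sub>v ?f + B' *\<^sub>v (G *\<^sub>v ?f) = B' *\<^sub>v (V *\<^sub>v z)" .
  have "A' *\<^sub>v ?f = (A' *\<^sub>v ?f + B' *\<^sub>v (G *\<^sub>v ?f)) - B' *\<^sub>v (G *\<^sub>v ?f)"
    using c 1 by (intro eq_vecI) auto
  also have "\<dots> = B' *\<^sub>v (V *\<^sub>v z - G *\<^sub>v ?f)"
    unfolding * using c 1 z by (intro mult_minus_distrib_mat_vec[symmetric]) auto
  finally have "A' *\<^sub>v ?f = B' *\<^sub>v (V *\<^sub>v z - G *\<^sub>v ?f)" .
  moreover have "V *\<^sub>v z - G *\<^sub>v ?f \<in> carrier_vec q'" using 1 z by auto
  ultimately show "f \<in> sol y" using c by (auto simp: e sol_def)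
qed

lemma eq_vec_if_minus_zero:
  fixes v w :: "'a::ab_group_add vec"
  assumes "v \<in> carrier_vec m" "w \<in> carrier_vec m" "v - w = 0\<^sub>v m"
  shows "v = w"
proof (rule eq_vecI)
  fix i assume i: "i < dim_vec w"
  have "(v - w) $ i = 0" using assms i by simp
  then show "v $ i = w $ i" using assms(1,2) i by simp
qed (use assms in auto)

lemma eq_mat_if_minus_zero:
  fixes M N :: "'a::ab_group_add mat"
  assumes "M \<in> carrier_mat m n" "N \<in> carrier_mat m n" "M - N = 0\<^sub>m m n"
  shows "M = N"
proof (rule eq_matI)
  fix i j assume i: "i < dim_row N" "j < dim_col N"
  have "(M - N) $$ (i, j) = 0" using assms i by simp
  then show "M $$ (i, j) = N $$ (i, j)" using assms(1,2) i by simp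
qed (use assms in auto)

text \<open>With generalized inverses \<open>X\<close> of \<open>B\<close> and \<open>X'\<close> of \<open>B'\<close>, the idempotents \<open>P = 1 - B X\<close> and
\<open>P' = 1 - B' X'\<close> have the column spaces of \<open>B\<close> and \<open>B'\<close> as kernels, so the solution spaces are the
kernels of \<open>M = P A\<close> and \<open>M' = P' A'\<close>. If the first kernel lies in the second, then a generalized
inverse \<open>N\<close> of \<open>M\<close> gives the factorization \<open>M' = M' N M\<close>, and \<open>U = M' N P\<close>, \<open>V = 0\<close>,
\<open>G = - X' A'\<close> witness the pre-order.\<close>

lemma mle_iff_sol:
  fixes x y :: "'a::division_ring mpair"
  assumes "x \<in> mpairs n" "y \<in> mpairs n"
  shows "(x, y) \<in> mle n \<longleftrightarrow> sol x \<subseteq> sol y"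
proof
  assume sub: "sol x \<subseteq> sol y"
  obtain B A B' A' where e: "x = (B, A)" "y = (B', A')" by force
  define p q where pq: "p = dim_row B" "q = dim_col B"
  define p' q' where pq': "p' = dim_row B'" "q' = dim_col B'"
  have c: "B \<in> carrier_mat p q" "A \<in> carrier_mat p n" "B' \<in> carrier_mat p' q'"
      "A' \<in> carrier_mat p' n"
    using assms unfolding e mpairs_def pq pq' by auto
  obtain X where X: "X \<in> carrier_mat q p" "B * X * B = B" using regular_mat[OF c(1)] by blast
  obtain X' where X': "X' \<in> carrier_mat q' p'" "B' * X' * B' = B'"
    using regular_mat[OF c(3)] by blast
  define P P' where "P = 1\<^sub>m p - B * X" and "P' = 1\<^sub>m p' - B' * X'"
  have P: "P \<in> carrier_mat p p" "P' \<in> carrier_mat p' p'" using c X X' by (auto simp: P_def P'_def)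
  have PM: "P * M = M - B * X * M" if "M \<in> carrier_mat p m" for M m
    unfolding P_def using that c X by (subst minus_mult_distrib_mat) auto
  have PM': "P' * M = M - B' * X' * M" if "M \<in> carrier_mat p' m" for M m
    unfolding P'_def using that c X' by (subst minus_mult_distrib_mat) auto
  have PB: "P * B = 0\<^sub>m p q" "P' * B' = 0\<^sub>m p' q'"
    using c PM[OF c(1)] PM'[OF c(3)] X X' by auto
  \<comment> \<open>\<open>K\<close> projects onto the kernel of \<open>M\<close>, so its columns are solutions of \<open>(B | A)\<close>,
    hence of \<open>(B' | A')\<close>, which yields \<open>M' K = 0\<close>.\<close>
  define M M' where "M = P * A" and "M' = P' * A'"
  have M: "M \<in> carrier_mat p n" "M' \<in> carrier_mat p' n" using c P by (auto simp: M_def M'_def)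
  obtain N where N: "N \<in> carrier_mat n p" "M * N * M = M" using regular_mat[OF M(1)] by blast
  define K where "K = 1\<^sub>m n - N * M"
  have K: "K \<in> carrier_mat n n" using N M by (auto simp: K_def)
  have "M * K = M * 1\<^sub>m n - M * (N * M)"
    unfolding K_def using N M by (intro mult_minus_distrib_mat) auto
  then have MK: "M * K = 0\<^sub>m p n" using N M by simp
  have "M' * K = 0\<^sub>m p' n"
  proof (rule eq_matI)
    fix i j assume ij: "i < dim_row (0\<^sub>m p' n)" "j < dim_col (0\<^sub>m p' n)"
    let ?k = "col K j"
    have k: "?k \<in> carrier_vec n" "vec n (\<lambda>i. ?k $ i) = ?k" using K by auto
    have "0\<^sub>v p = M *\<^sub>v ?k"
      using ij K M MK by (metis col_mult2 col_zero index_zero_mat(3))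
    also have "\<dots> = P *\<^sub>v (A *\<^sub>v ?k)" unfolding M_def using P c k by simp
    also have "\<dots> = A *\<^sub>v ?k - B *\<^sub>v (X *\<^sub>v (A *\<^sub>v ?k))"
      unfolding P_def using c X k by (subst minus_mult_distrib_mat_vec) auto
    finally have "A *\<^sub>v ?k - B *\<^sub>v (X *\<^sub>v (A *\<^sub>v ?k)) = 0\<^sub>v p" by simp
    then have "A *\<^sub>v ?k = B *\<^sub>v (X *\<^sub>v (A *\<^sub>v ?k))"
      by (rule eq_vec_if_minus_zero[rotated 2]) (use c X k(1) in auto)
    then have "(\<lambda>i. ?k $ i) \<in> sol x"
      using c X k by (auto simp: e sol_def intro!: bexI[of _ "X *\<^sub>v (A *\<^sub>v ?k)"])
    with sub have "(\<lambda>i. ?k $ i) \<in> sol y" by blast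
    then obtain z where z: "z \<in> carrier_vec q'" "A' *\<^sub>v ?k = B' *\<^sub>v z"
      using c k by (auto simp: e sol_def)
    have "M' *\<^sub>v ?k = P' *\<^sub>v (A' *\<^sub>v ?k)" unfolding M'_def using P c k by simp
    also have "\<dots> = (P' * B') *\<^sub>v z" unfolding z using P c z by simp
    also have "\<dots> = 0\<^sub>v p'" unfolding PB using z by (intro eq_vecI) auto
    finally have "col (M' * K) j = 0\<^sub>v p'" using M K ij by (subst col_mult2) auto
    then show "(M' * K) $$ (i, j) = 0\<^sub>m p' n $$ (i, j)"
      using ij M K by (metis carrier_matD(1,2) index_col index_mult_mat(2,3) index_zero_mat index_zero_vec(1))
  qed (use M K in auto)
  moreover have "M' * K = M' * 1\<^sub>m n - M' * (N * M)"
    unfolding K_def using N M by (intro mult_minus_distrib_mat) auto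
  ultimately have "M' - M' * (N * M) = 0\<^sub>m p' n" using M by simp
  then have M'N: "M' * (N * M) = M'"
    using eq_mat_if_minus_zero[of M' p' n "M' * (N * M)"] M N by simp
  define U where "U = M' * N * P"
  have U: "U \<in> carrier_mat p' p" using M N P by (auto simp: U_def)
  have "U * B = M' * N * (P * B)" unfolding U_def using M N P c by (intro assoc_mult_mat) auto
  then have 1: "U * B = B' * 0\<^sub>m q' q" unfolding PB using M N c by simp
  have "U * A = M' * N * (P * A)" unfolding U_def using M N P c by (intro assoc_mult_mat) auto
  also have "\<dots> = M'" unfolding M_def[symmetric] using M'N M N by simp
  also have "\<dots> = A' + B' * (- (X' * A'))"
    unfolding M'_def PM'[OF c(4)] using c X' by (intro eq_matI) auto
  finally have 2: "U * A = A' + B' * (- (X' * A'))" .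
  have "- (X' * A') \<in> carrier_mat q' n" using c X' by auto
  then show "(x, y) \<in> mle n"
    using mleI[OF _ _ _ _ _ 1 2] assms U unfolding e pq pq' by simp
qed (rule sol_mono)

section \<open>Faces as sections and projections\<close>

text \<open>Inserting a coordinate at position \<open>i\<close>. Vectors are functions on all of \<open>nat\<close>, of which a pair with
\<open>n\<close> columns only looks at the first \<open>n\<close> values; this avoids a separate type for each dimension.\<close>

definition ins :: "nat \<Rightarrow> 'a \<Rightarrow> (nat \<Rightarrow> 'a) \<Rightarrow> nat \<Rightarrow> 'a" where
  "ins i t f = (\<lambda>j. if j < i then f j else if j = i then t else f (j - 1))"

text \<open>The cubical identity behind the fact that faces of degenerate elements are degenerate.\<close>

lemma ins_ins: "i \<le> j \<Longrightarrow> ins (Suc j) s (ins i t f) = ins i t (ins j s f)"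
  by (auto simp: ins_def fun_eq_iff)

lemma sum_mult_ins:
  fixes a :: "nat \<Rightarrow> 'a::ring_1"
  assumes "i \<le> n"
  shows "(\<Sum>j<Suc n. a j * ins i t f j) = (\<Sum>j<n. a (if j < i then j else Suc j) * f j) + a i * t"
  using assms
proof (induction n)
  case 0
  then show ?case by (simp add: ins_def)
next
  case (Suc n)
  show ?case
  proof (cases "i \<le> n")
    case True
    have "(\<Sum>j<Suc (Suc n). a j * ins i t f j) = (\<Sum>j<Suc n. a j * ins i t f j) + a (Suc n) * f n"
      using True by (simp add: ins_def)
    then show ?thesis using Suc.IH[OF True] True by (simp add: algebra_simps)
  next
    case False
    then have i: "i = Suc n" using Suc.prems by simp
    have "(\<Sum>j<Suc n. a j * ins i t f j) = (\<Sum>j<Suc n. a (if j < i then j else Suc j) * f j)"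
      unfolding i by (intro sum.cong) (auto simp: ins_def)
    then show ?thesis by (simp add: i ins_def)
  qed
qed

lemma sol_iff:
  "f \<in> sol (B, A) \<longleftrightarrow> (\<exists>y. \<forall>r<dim_row A.
     (\<Sum>j<dim_col A. A $$ (r, j) * f j) = (\<Sum>j<dim_col B. B $$ (r, j) * y j))"
  if "dim_row B = dim_row A"
proof -
  have A: "(A *\<^sub>v vec (dim_col A) f) $ r = (\<Sum>j<dim_col A. A $$ (r, j) * f j)"
    if "r < dim_row A" for r
    using that by (simp add: scalar_prod_def lessThan_atLeast0)
  have B: "(B *\<^sub>v vec (dim_col B) y) $ r = (\<Sum>j<dim_col B. B $$ (r, j) * y j)"
    if "r < dim_row B" for r y
    using that by (simp add: scalar_prod_def lessThan_atLeast0)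
  have eq: "A *\<^sub>v vec (dim_col A) f = B *\<^sub>v vec (dim_col B) y \<longleftrightarrow>
    (\<forall>r<dim_row A. (\<Sum>j<dim_col A. A $$ (r, j) * f j) = (\<Sum>j<dim_col B. B $$ (r, j) * y j))" for y
    using \<open>dim_row B = dim_row A\<close> by (simp add: vec_eq_iff A B del: index_mult_mat_vec)
  have "f \<in> sol (B, A) \<longleftrightarrow> (\<exists>y. A *\<^sub>v vec (dim_col A) f = B *\<^sub>v vec (dim_col B) y)"
  proof
    assume "f \<in> sol (B, A)"
    then obtain y where y: "y \<in> carrier_vec (dim_col B)" "A *\<^sub>v vec (dim_col A) f = B *\<^sub>v y"
      by (auto simp: sol_def)
    moreover have "vec (dim_col B) (\<lambda>i. y $ i) = y" using y(1) by auto
    ultimately show "\<exists>y. A *\<^sub>v vec (dim_col A) f = B *\<^sub>v vec (dim_col B) y" by metis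
  qed (auto simp: sol_def)
  then show ?thesis unfolding eq .
qed

lemma sol_cong:
  assumes "x \<in> mpairs n" "\<And>j. j < n \<Longrightarrow> f j = g j"
  shows "f \<in> sol x \<longleftrightarrow> g \<in> sol x"
proof -
  have "vec n f = vec n g" using assms by auto
  then show ?thesis using assms(1) by (auto simp: mpairs_def sol_def)
qed

lemma sol_diff:
  assumes "x \<in> mpairs n" "f \<in> sol x" "g \<in> sol x"
  shows "(\<lambda>j. f j - g j) \<in> sol x"
proof -
  obtain B A where x: "x = (B, A)" by force
  have d: "dim_row B = dim_row A" using assms(1) by (simp add: x mpairs_def)
  obtain y where
    y: "\<forall>r<dim_row A. (\<Sum>j<dim_col A. A $$ (r, j) * f j) = (\<Sum>j<dim_col B. B $$ (r, j) * y j)"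
    using assms(2) unfolding x sol_iff[OF d] by blast
  obtain z where
    z: "\<forall>r<dim_row A. (\<Sum>j<dim_col A. A $$ (r, j) * g j) = (\<Sum>j<dim_col B. B $$ (r, j) * z j)"
    using assms(3) unfolding x sol_iff[OF d] by blast
  show ?thesis
    using y z unfolding x sol_iff[OF d]
    by (intro exI[of _ "\<lambda>j. y j - z j"]) (auto simp: right_diff_distrib sum_subtractf)
qed

lemma sol_scale:
  assumes "x \<in> mpairs n" "f \<in> sol x"
  shows "(\<lambda>j. f j * c) \<in> sol x"
proof -
  obtain B A where x: "x = (B, A)" by force
  have d: "dim_row B = dim_row A" using assms(1) by (simp add: x mpairs_def)
  obtain y where
    "\<forall>r<dim_row A. (\<Sum>j<dim_col A. A $$ (r, j) * f j) = (\<Sum>j<dim_col B. B $$ (r, j) * y j)"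
    using assms(2) unfolding x sol_iff[OF d] by blast
  then show ?thesis
    unfolding x sol_iff[OF d]
    by (intro exI[of _ "\<lambda>j. y j * c"]) (auto simp flip: mult.assoc sum_distrib_right)
qed

lemma N_rep_mpairs: "x \<in> mpairs (Suc n) \<Longrightarrow> N_rep i x \<in> mpairs n"
  by (auto simp: mpairs_def N_rep_def del_col_def)

lemma E_rep_mpairs: "x \<in> mpairs (Suc n) \<Longrightarrow> E_rep i x \<in> mpairs n"
  by (auto simp: mpairs_def E_rep_def del_col_def snoc_col_def)

lemma sum_del_col:
  fixes A :: "'a::ring_1 mat"
  assumes "dim_col A = Suc n" "i \<le> n" "r < dim_row A"
  shows "(\<Sum>j<Suc n. A $$ (r, j) * ins i t f j) = (\<Sum>j<n. del_col i A $$ (r, j) * f j) + A $$ (r, i) * t"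
  unfolding sum_mult_ins[OF assms(2)] using assms
  by (intro arg_cong2[of _ _ _ _ "(+)"] sum.cong) (auto simp: del_col_def)

lemma sol_N_rep:
  assumes "x \<in> mpairs (Suc n)" "i \<le> n"
  shows "sol (N_rep i x) = {f. ins i 0 f \<in> sol x}"
proof -
  obtain B A where x: "x = (B, A)" by force
  have d: "dim_row B = dim_row A" "dim_col A = Suc n" using assms(1) by (auto simp: x mpairs_def)
  have d': "dim_row (del_col i A) = dim_row A" "dim_col (del_col i A) = n"
    using d by (auto simp: del_col_def)
  show ?thesis
    using sum_del_col[OF d(2) assms(2), where t = 0]
    by (auto simp: x N_rep_def sol_iff d d' simp del: sum.lessThan_Suc)
qed

text \<open>Moving the column \<open>A\<^sub>i\<close> into \<open>B\<close> replaces the \<open>i\<close>-th coordinate by an existentially quantified one,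
up to a sign: the new unknown is the negative of the inserted coordinate.\<close>

lemma sol_E_rep:
  assumes "x \<in> mpairs (Suc n)" "i \<le> n"
  shows "sol (E_rep i x) = {f. \<exists>t. ins i t f \<in> sol x}"
proof -
  obtain B A where x: "x = (B, A)" by force
  have d: "dim_row B = dim_row A" "dim_col A = Suc n" using assms(1) by (auto simp: x mpairs_def)
  define B' where "B' = snoc_col B (col A i)"
  have d': "dim_row (del_col i A) = dim_row A" "dim_col (del_col i A) = n"
      "dim_row B' = dim_row A" "dim_col B' = Suc (dim_col B)"
    using d by (auto simp: del_col_def B'_def snoc_col_def)
  have B': "(\<Sum>j<Suc (dim_col B). B' $$ (r, j) * y j) =
      (\<Sum>j<dim_col B. B $$ (r, j) * y j) + A $$ (r, i) * y (dim_col B)" if "r < dim_row A" for r y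
    using that d assms(2) by (auto simp: B'_def snoc_col_def intro!: sum.cong)
  have "f \<in> sol (E_rep i x) \<longleftrightarrow> (\<exists>t. ins i t f \<in> sol x)" for f
  proof
    assume "f \<in> sol (E_rep i x)"
    then obtain y where "\<forall>r<dim_row A. (\<Sum>j<n. del_col i A $$ (r, j) * f j) =
        (\<Sum>j<dim_col B. B $$ (r, j) * y j) + A $$ (r, i) * y (dim_col B)"
      by (auto simp: x E_rep_def sol_iff d d' B' simp flip: B'_def simp del: sum.lessThan_Suc)
    then have "ins i (- y (dim_col B)) f \<in> sol x"
      unfolding x sol_iff[OF d(1)] d(2) using sum_del_col[OF d(2) assms(2)]
      by (intro exI[of _ y]) (simp del: sum.lessThan_Suc)
    then show "\<exists>t. ins i t f \<in> sol x" ..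
  next
    assume "\<exists>t. ins i t f \<in> sol x"
    then obtain t y where "\<forall>r<dim_row A. (\<Sum>j<Suc n. A $$ (r, j) * ins i t f j) =
        (\<Sum>j<dim_col B. B $$ (r, j) * y j)"
      unfolding x sol_iff[OF d(1)] d(2) by blast
    then have "\<forall>r<dim_row A. (\<Sum>j<n. del_col i A $$ (r, j) * f j) + A $$ (r, i) * t =
        (\<Sum>j<dim_col B. B $$ (r, j) * y j)"
      by (simp add: sum_del_col[OF d(2) assms(2)] del: sum.lessThan_Suc)
    then have "\<forall>r<dim_row A. (\<Sum>j<n. del_col i A $$ (r, j) * f j) =
        (\<Sum>j<Suc (dim_col B). B' $$ (r, j) * (if j < dim_col B then y j else - t))"
      by (simp add: B' eq_diff_eq del: sum.lessThan_Suc)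
    then show "f \<in> sol (E_rep i x)"
      by (auto simp: x E_rep_def sol_iff d d' simp flip: B'_def simp del: sum.lessThan_Suc)
  qed
  then show ?thesis by blast
qed

text \<open>The union ranges over all representatives of a class, which share one solution space by \<open>sol_mono\<close>.\<close>

definition csol :: "'a::ring_1 mclass \<Rightarrow> (nat \<Rightarrow> 'a) set" where
  "csol X = (\<Union>x\<in>X. sol x)"

lemma csol_class: "csol (meq n `` {x}) = sol x" if "x \<in> mpairs n"
proof -
  have "sol y \<subseteq> sol x" if "(x, y) \<in> meq n" for y
    using that sol_mono[of y x n] by (simp add: meq_def)
  moreover have "(x, x) \<in> meq n"
    using that equiv_meq[of n] by (auto simp: equiv_def refl_on_def)
  ultimately show ?thesis unfolding csol_def by blast
qed

lemma LsetE:
  assumes "X \<in> Lset n"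
  obtains x where "x \<in> mpairs n" "X = meq n `` {x}" "csol X = sol x"
  using assms unfolding Lset_def by (metis csol_class quotientE)

lemma LsetI: "x \<in> mpairs n \<Longrightarrow> meq n `` {x} \<in> Lset n"
  by (simp add: Lset_def quotientI)

lemma csol_inject:
  fixes X Y :: "'a::division_ring mclass"
  assumes "X \<in> Lset n" "Y \<in> Lset n" "csol X = csol Y"
  shows "X = Y"
proof -
  obtain x where x: "x \<in> mpairs n" "X = meq n `` {x}" "csol X = sol x" using assms(1) by (rule LsetE)
  obtain y where y: "y \<in> mpairs n" "Y = meq n `` {y}" "csol Y = sol y" using assms(2) by (rule LsetE)
  have "(x, y) \<in> meq n"
    using assms(3) x y by (auto simp: meq_def mle_iff_sol)
  then show ?thesis using x y equiv_class_eq[OF equiv_meq] by metis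
qed

lemma csol_cong:
  assumes "X \<in> Lset n" "\<And>j. j < n \<Longrightarrow> f j = g j"
  shows "f \<in> csol X \<longleftrightarrow> g \<in> csol X"
proof -
  obtain x where "x \<in> mpairs n" "csol X = sol x" using assms(1) by (rule LsetE)
  then show ?thesis using sol_cong[of x n f g] assms(2) by simp
qed

lemma csol_diff:
  assumes "X \<in> Lset n" "f \<in> csol X" "g \<in> csol X"
  shows "(\<lambda>j. f j - g j) \<in> csol X"
proof -
  obtain x where "x \<in> mpairs n" "csol X = sol x" using assms(1) by (rule LsetE)
  then show ?thesis using sol_diff assms(2,3) by simp
qed

lemma csol_scale:
  assumes "X \<in> Lset n" "f \<in> csol X"
  shows "(\<lambda>j. f j * c) \<in> csol X"
proof -
  obtain x where "x \<in> mpairs n" "csol X = sol x" using assms(1) by (rule LsetE)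
  then show ?thesis using sol_scale assms(2) by simp
qed

lemma face_N_sol:
  assumes "X \<in> Lset (Suc n)" "i \<le> n"
  shows "face_N n i X \<in> Lset n" "csol (face_N n i X) = {f. ins i 0 f \<in> csol X}"
proof -
  obtain x where x: "x \<in> mpairs (Suc n)" "X = meq (Suc n) `` {x}" "csol X = sol x"
    using assms(1) by (rule LsetE)
  show "face_N n i X \<in> Lset n" "csol (face_N n i X) = {f. ins i 0 f \<in> csol X}"
    using x assms(2) by (simp_all add: N_class LsetI N_rep_mpairs csol_class sol_N_rep)
qed

lemma face_E_sol:
  assumes "X \<in> Lset (Suc n)" "i \<le> n"
  shows "face_E n i X \<in> Lset n" "csol (face_E n i X) = {f. \<exists>t. ins i t f \<in> csol X}"
proof -
  obtain x where x: "x \<in> mpairs (Suc n)" "X = meq (Suc n) `` {x}" "csol X = sol x"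
    using assms(1) by (rule LsetE)
  show "face_E n i X \<in> Lset n" "csol (face_E n i X) = {f. \<exists>t. ins i t f \<in> csol X}"
    using x assms(2) by (simp_all add: E_class LsetI E_rep_mpairs csol_class sol_E_rep)
qed

text \<open>A subspace is flat at \<open>i\<close> if the projection along the \<open>i\<close>-th axis agrees with the section by
\<open>x\<^sub>i = 0\<close>; equivalently, it is the sum of that section and a subspace of the axis.\<close>

definition flat :: "nat \<Rightarrow> (nat \<Rightarrow> 'a::zero) set \<Rightarrow> bool" where
  "flat i S \<longleftrightarrow> (\<forall>f t. ins i t f \<in> S \<longrightarrow> ins i 0 f \<in> S)"

lemma faces_eq_iff_flat:
  fixes X :: "'a::division_ring mclass"
  assumes "X \<in> Lset (Suc n)" "i \<le> n"
  shows "face_E n i X = face_N n i X \<longleftrightarrow> flat i (csol X)"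
proof
  assume "face_E n i X = face_N n i X"
  then have "csol (face_E n i X) = csol (face_N n i X)" by simp
  then show "flat i (csol X)"
    unfolding face_E_sol(2)[OF assms] face_N_sol(2)[OF assms] by (auto simp: flat_def)
next
  assume "flat i (csol X)"
  then have "csol (face_E n i X) = csol (face_N n i X)"
    unfolding face_E_sol(2)[OF assms] face_N_sol(2)[OF assms] by (auto simp: flat_def)
  then show "face_E n i X = face_N n i X"
    using csol_inject face_E_sol(1)[OF assms] face_N_sol(1)[OF assms] by blast
qed

lemma degenerate_iff_flat:
  "degenerate n (X :: 'a::division_ring mclass) \<longleftrightarrow> X \<in> Lset (Suc n) \<and> (\<exists>i\<le>n. flat i (csol X))"
  unfolding degenerate_def Suc_eq_plus1[symmetric] using faces_eq_iff_flat by blast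

lemma flat_face_below:
  assumes "X \<in> Lset (Suc n)" "i \<le> j" "Suc j \<le> n" "flat i (csol X)"
  shows "flat i (csol (face_E n (Suc j) X))" "flat i (csol (face_N n (Suc j) X))"
  using assms(2-4)
  by (auto simp: flat_def face_E_sol(2)[OF assms(1,3)] face_N_sol(2)[OF assms(1,3)] ins_ins[OF assms(2)])

lemma flat_face_above:
  assumes "X \<in> Lset (Suc n)" "j \<le> i" "Suc i \<le> n" "flat (Suc i) (csol X)"
  shows "flat i (csol (face_E n j X))" "flat i (csol (face_N n j X))"
proof -
  have j: "j \<le> n" using assms by simp
  show "flat i (csol (face_E n j X))" "flat i (csol (face_N n j X))"
    using assms(4)
    by (auto simp: flat_def face_E_sol(2)[OF assms(1) j] face_N_sol(2)[OF assms(1) j]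
        ins_ins[OF assms(2), symmetric])
qed

text \<open>The two faces at the index \<open>i\<close> itself cancel in the boundary, so together with this
the degenerate chains form a subcomplex.\<close>

lemma degenerate_faces:
  fixes X :: "'a::division_ring mclass"
  assumes "X \<in> Lset (Suc (Suc n))" "flat i (csol X)" "i \<le> Suc n" "j \<le> Suc n" "j \<noteq> i"
  shows "degenerate n (face_E (Suc n) j X)" "degenerate n (face_N (Suc n) j X)"
proof -
  have "\<exists>i'\<le>n. flat i' (csol (face_E (Suc n) j X)) \<and> flat i' (csol (face_N (Suc n) j X))"
  proof (cases "i < j")
    case True
    then obtain j' where "j = Suc j'" "i \<le> j'" by (cases j) auto
    then show ?thesis
      using flat_face_below[OF assms(1) _ _ assms(2), of j'] assms(4) by (intro exI[of _ i]) simp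
  next
    case False
    then obtain i' where "i = Suc i'" "j \<le> i'" using assms(5) by (cases i) auto
    then show ?thesis using flat_face_above[OF assms(1), of j i'] assms(2-4) by (intro exI[of _ i']) simp
  qed
  then show "degenerate n (face_E (Suc n) j X)" "degenerate n (face_N (Suc n) j X)"
    using face_E_sol(1)[OF assms(1,4)] face_N_sol(1)[OF assms(1,4)] by (auto simp: degenerate_iff_flat)
qed

section \<open>Subspaces of the plane and of three-space\<close>

definition pt :: "'a::zero list \<Rightarrow> nat \<Rightarrow> 'a" where
  "pt xs = (\<lambda>j. if j < length xs then xs ! j else 0)"

lemma ins_pt:
  "ins 0 t (pt [a]) = pt [t, a]" "ins (Suc 0) t (pt [a]) = pt [a, t]"
  "ins 0 t (pt [a, b]) = pt [t, a, b]" "ins (Suc 0) t (pt [a, b]) = pt [a, t, b]"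
  "ins 2 t (pt [a, b]) = pt [a, b, t]"
  by (auto simp: ins_def pt_def fun_eq_iff less_Suc_eq nth_Cons' numeral_2_eq_2)

lemma csol_pt:
  assumes "X \<in> Lset (length xs)" "\<And>j. j < length xs \<Longrightarrow> f j = xs ! j"
  shows "f \<in> csol X \<longleftrightarrow> pt xs \<in> csol X"
  using assms by (intro csol_cong) (auto simp: pt_def)

definition on_plane :: "'a::ring_1 mclass \<Rightarrow> 'a \<Rightarrow> 'a \<Rightarrow> bool" where
  "on_plane X a b \<longleftrightarrow> pt [a, b] \<in> csol X"

definition on_space :: "'a::ring_1 mclass \<Rightarrow> 'a \<Rightarrow> 'a \<Rightarrow> 'a \<Rightarrow> bool" where
  "on_space X a b c \<longleftrightarrow> pt [a, b, c] \<in> csol X"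

lemma on_plane_iff: "X \<in> Lset 2 \<Longrightarrow> f \<in> csol X \<longleftrightarrow> on_plane X (f 0) (f 1)"
  unfolding on_plane_def by (intro csol_pt) (auto simp: less_Suc_eq numeral_2_eq_2)

lemma on_space_iff: "X \<in> Lset 3 \<Longrightarrow> f \<in> csol X \<longleftrightarrow> on_space X (f 0) (f 1) (f 2)"
  unfolding on_space_def by (intro csol_pt) (auto simp: less_Suc_eq numeral_3_eq_3 numeral_2_eq_2)

lemma on_plane_diff:
  assumes "X \<in> Lset 2" "on_plane X a b" "on_plane X a' b'"
  shows "on_plane X (a - a') (b - b')"
  using csol_diff[OF assms(1), of "pt [a, b]" "pt [a', b']"] assms
  by (simp add: on_plane_iff) (simp add: pt_def)

lemma on_plane_scale:
  assumes "X \<in> Lset 2" "on_plane X a b"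
  shows "on_plane X (a * c) (b * c)"
  using csol_scale[OF assms(1), of "pt [a, b]"] assms
  by (simp add: on_plane_iff) (simp add: pt_def)

lemma on_space_diff:
  assumes "X \<in> Lset 3" "on_space X a b c" "on_space X a' b' c'"
  shows "on_space X (a - a') (b - b') (c - c')"
  using csol_diff[OF assms(1), of "pt [a, b, c]" "pt [a', b', c']"] assms
  by (simp add: on_space_iff) (simp add: pt_def)

lemma on_space_scale:
  assumes "X \<in> Lset 3" "on_space X a b c"
  shows "on_space X (a * d) (b * d) (c * d)"
  using csol_scale[OF assms(1), of "pt [a, b, c]"] assms
  by (simp add: on_space_iff) (simp add: pt_def)

lemma on_plane_inject:
  fixes X Y :: "'a::division_ring mclass"
  assumes "X \<in> Lset 2" "Y \<in> Lset 2" "\<And>a b. on_plane X a b \<longleftrightarrow> on_plane Y a b"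
  shows "X = Y"
  using assms by (intro csol_inject[OF assms(1,2)]) (auto simp: on_plane_iff)

lemma flat_plane:
  assumes "X \<in> Lset 2"
  shows "flat 0 (csol X) \<longleftrightarrow> (\<forall>a b. on_plane X a b \<longrightarrow> on_plane X 0 b)"
    and "flat (Suc 0) (csol X) \<longleftrightarrow> (\<forall>a b. on_plane X a b \<longrightarrow> on_plane X a 0)"
proof -
  show "flat 0 (csol X) \<longleftrightarrow> (\<forall>a b. on_plane X a b \<longrightarrow> on_plane X 0 b)"
  proof
    assume "flat 0 (csol X)"
    then show "\<forall>a b. on_plane X a b \<longrightarrow> on_plane X 0 b"
      unfolding flat_def on_plane_def using ins_pt(1) by metis
  qed (simp add: flat_def on_plane_iff[OF assms] ins_def)
  show "flat (Suc 0) (csol X) \<longleftrightarrow> (\<forall>a b. on_plane X a b \<longrightarrow> on_plane X a 0)"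
  proof
    assume "flat (Suc 0) (csol X)"
    then show "\<forall>a b. on_plane X a b \<longrightarrow> on_plane X a 0"
      unfolding flat_def on_plane_def using ins_pt(2) by metis
  qed (simp add: flat_def on_plane_iff[OF assms] ins_def)
qed

lemma flat_space:
  assumes "X \<in> Lset 3"
  shows "flat 0 (csol X) \<longleftrightarrow> (\<forall>a b c. on_space X a b c \<longrightarrow> on_space X 0 b c)"
    and "flat (Suc 0) (csol X) \<longleftrightarrow> (\<forall>a b c. on_space X a b c \<longrightarrow> on_space X a 0 c)"
    and "flat 2 (csol X) \<longleftrightarrow> (\<forall>a b c. on_space X a b c \<longrightarrow> on_space X a b 0)"
proof -
  show "flat 0 (csol X) \<longleftrightarrow> (\<forall>a b c. on_space X a b c \<longrightarrow> on_space X 0 b c)"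
  proof
    assume "flat 0 (csol X)"
    then show "\<forall>a b c. on_space X a b c \<longrightarrow> on_space X 0 b c"
      unfolding flat_def on_space_def using ins_pt(3) by metis
  qed (simp add: flat_def on_space_iff[OF assms] ins_def)
  show "flat (Suc 0) (csol X) \<longleftrightarrow> (\<forall>a b c. on_space X a b c \<longrightarrow> on_space X a 0 c)"
  proof
    assume "flat (Suc 0) (csol X)"
    then show "\<forall>a b c. on_space X a b c \<longrightarrow> on_space X a 0 c"
      unfolding flat_def on_space_def using ins_pt(4) by metis
  qed (simp add: flat_def on_space_iff[OF assms] ins_def)
  show "flat 2 (csol X) \<longleftrightarrow> (\<forall>a b c. on_space X a b c \<longrightarrow> on_space X a b 0)"
  proof
    assume "flat 2 (csol X)"
    then show "\<forall>a b c. on_space X a b c \<longrightarrow> on_space X a b 0"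
      unfolding flat_def on_space_def using ins_pt(5) by metis
  qed (simp add: flat_def on_space_iff[OF assms] ins_def)
qed

lemma faces_in_plane:
  assumes "X \<in> Lset 3" "i \<le> 2"
  shows "face_E 2 i X \<in> Lset 2" "face_N 2 i X \<in> Lset 2"
  using face_E_sol(1)[of X 2 i] face_N_sol(1)[of X 2 i] assms by (simp_all add: numeral_3_eq_3)

lemma on_plane_faces:
  assumes "X \<in> Lset 3"
  shows "on_plane (face_E 2 0 X) a b \<longleftrightarrow> (\<exists>t. on_space X t a b)"
    "on_plane (face_E 2 (Suc 0) X) a b \<longleftrightarrow> (\<exists>t. on_space X a t b)"
    "on_plane (face_E 2 2 X) a b \<longleftrightarrow> (\<exists>t. on_space X a b t)"
    "on_plane (face_N 2 0 X) a b \<longleftrightarrow> on_space X 0 a b"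
    "on_plane (face_N 2 (Suc 0) X) a b \<longleftrightarrow> on_space X a 0 b"
    "on_plane (face_N 2 2 X) a b \<longleftrightarrow> on_space X a b 0"
proof -
  have X: "X \<in> Lset (Suc 2)" using assms by (simp add: numeral_3_eq_3)
  show "on_plane (face_E 2 0 X) a b \<longleftrightarrow> (\<exists>t. on_space X t a b)"
    "on_plane (face_E 2 (Suc 0) X) a b \<longleftrightarrow> (\<exists>t. on_space X a t b)"
    "on_plane (face_E 2 2 X) a b \<longleftrightarrow> (\<exists>t. on_space X a b t)"
    "on_plane (face_N 2 0 X) a b \<longleftrightarrow> on_space X 0 a b"
    "on_plane (face_N 2 (Suc 0) X) a b \<longleftrightarrow> on_space X a 0 b"
    "on_plane (face_N 2 2 X) a b \<longleftrightarrow> on_space X a b 0"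
    by (simp_all add: on_plane_def on_space_def face_E_sol(2)[OF X] face_N_sol(2)[OF X] ins_pt)
qed

text \<open>The class of \<open>(0 | A)\<close>, with no columns in the left matrix: the subspace cut out by the \<open>m\<close> linear
equations \<open>A x = 0\<close>.\<close>

definition kernel_class :: "nat \<Rightarrow> nat \<Rightarrow> (nat \<Rightarrow> nat \<Rightarrow> 'a) \<Rightarrow> 'a::ring_1 mclass" where
  "kernel_class m n A = meq n `` {(0\<^sub>m m 0, mat m n (\<lambda>(i, j). A i j))}"

lemma kernel_class_Lset: "kernel_class m n A \<in> Lset n"
  unfolding kernel_class_def by (rule LsetI) (simp add: mpairs_def)

lemma csol_kernel_class:
  "f \<in> csol (kernel_class m n A) \<longleftrightarrow> (\<forall>r<m. (\<Sum>j<n. A r j * f j) = 0)"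
proof -
  have "(0\<^sub>m m 0, mat m n (\<lambda>(i, j). A i j)) \<in> mpairs n" by (simp add: mpairs_def)
  then show ?thesis
    unfolding kernel_class_def by (subst csol_class) (auto simp: sol_iff)
qed

text \<open>The equation is \<open>a x\<^sub>0 - x\<^sub>1 = 0\<close>. Coefficients stand on the left of the unknowns, as in every
solution space, and this fixes the order of the factors in all slopes below.\<close>

definition line :: "'a \<Rightarrow> 'a::ring_1 mclass" where
  "line a = kernel_class 1 2 (\<lambda>_ j. [a, -1] ! j)"

lemma line_Lset: "line a \<in> Lset 2"
  unfolding line_def by (rule kernel_class_Lset)

lemma on_line: "on_plane (line a) x y \<longleftrightarrow> y = a * x"
  unfolding line_def on_plane_def csol_kernel_class
  by (auto simp: pt_def lessThan_Suc numeral_2_eq_2)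

lemma line_inject: "line a = line b \<longleftrightarrow> a = b"
  using on_line[of a 1 a] on_line[of b 1 a] by auto

text \<open>Flatness at one of the two axes implies flatness at the other: \<open>(a, b) - (a, 0) = (0, b)\<close>.\<close>

lemma degenerate_plane_iff:
  fixes X :: "'a::division_ring mclass"
  shows "degenerate 1 X \<longleftrightarrow> X \<in> Lset 2 \<and> flat 0 (csol X) \<and> flat (Suc 0) (csol X)"
proof -
  have "flat 0 (csol X) \<longleftrightarrow> flat (Suc 0) (csol X)" if X: "X \<in> Lset 2"
  proof -
    have "on_plane X a 0 \<longleftrightarrow> on_plane X 0 b" if "on_plane X a b" for a b
      using on_plane_diff[OF X that, of a 0] on_plane_diff[OF X that, of 0 b] by auto
    then show ?thesis unfolding flat_plane[OF X] by blast
  qed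
  then show ?thesis
    unfolding degenerate_iff_flat by (auto simp: le_Suc_eq numeral_2_eq_2)
qed

lemma line_not_degenerate:
  fixes a :: "'a::division_ring"
  assumes "a \<noteq> 0"
  shows "\<not> degenerate 1 (line a)"
proof -
  have "on_plane (line a) 1 a" "\<not> on_plane (line a) 0 a"
    using assms by (simp_all add: on_line)
  then show ?thesis
    unfolding degenerate_plane_iff flat_plane[OF line_Lset] by blast
qed

text \<open>A subspace that is not flat contains some \<open>(1, a)\<close> but no nonzero point \<open>(0, w)\<close>, and subtracting
multiples of \<open>(1, a)\<close> shows that it is the line of slope \<open>a\<close>.\<close>

lemma plane_cases:
  fixes X :: "'a::division_ring mclass"
  assumes X: "X \<in> Lset 2"
  obtains "degenerate 1 X" | a where "a \<noteq> 0" "X = line a"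
proof (cases "degenerate 1 X")
  case False
  obtain x y where xy: "on_plane X x y" "\<not> on_plane X 0 y"
    using False X unfolding degenerate_iff_flat using flat_plane(1)[OF X] by (auto simp: numeral_2_eq_2)
  obtain u v where uv: "on_plane X u v" "\<not> on_plane X u 0"
    using False X unfolding degenerate_iff_flat using flat_plane(2)[OF X] by (auto simp: numeral_2_eq_2)
  define a where "a = y * inverse x"
  have x: "x \<noteq> 0" using xy by auto
  have 1: "on_plane X 1 a" using on_plane_scale[OF X xy(1), of "inverse x"] x by (simp add: a_def)
  \<comment> \<open>A nonzero point of \<open>X\<close> on the second axis would have \<open>(0, y)\<close> as a multiple.\<close>
  have zero: "w = 0" if "on_plane X 0 w" for w
  proof (rule ccontr)
    assume "w \<noteq> 0"
    then have "on_plane X 0 y" using on_plane_scale[OF X that, of "inverse w * y"] by (simp flip: mult.assoc)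
    with xy(2) show False ..
  qed
  have iff: "on_plane X r s \<longleftrightarrow> s = a * r" for r s
  proof
    assume "on_plane X r s"
    then have "on_plane X 0 (s - a * r)" using on_plane_diff[OF X _ on_plane_scale[OF X 1, of r]] by force
    then show "s = a * r" using zero by fastforce
  qed (use on_plane_scale[OF X 1, of r] in simp)
  have "a \<noteq> 0" using uv iff by auto
  moreover have "X = line a"
    by (rule on_plane_inject[OF X line_Lset]) (simp add: iff on_line)
  ultimately show ?thesis by (rule that(2))
qed

lemma degenerate_planeI:
  fixes Y :: "'a::division_ring mclass"
  assumes "Y \<in> Lset 2" "\<And>u v. on_plane Y u v \<Longrightarrow> on_plane Y 0 v"
  shows "degenerate 1 Y"
  unfolding degenerate_iff_flat using assms flat_plane(1)[OF assms(1)] by (auto simp: numeral_2_eq_2)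

lemma all_le_2: "(\<forall>i\<le>2. P i) \<longleftrightarrow> P 0 \<and> P (Suc 0) \<and> P (2::nat)"
  by (auto simp: le_Suc_eq numeral_2_eq_2)

text \<open>The line spanned by \<open>(1, a, c a)\<close>: its three projections are lines with the slopes of pairs of
coordinates, and its sections are zero.\<close>

lemma faces_of_line:
  fixes X :: "'a::division_ring mclass"
  assumes X: "X \<in> Lset 3" and ac: "a \<noteq> 0" "c \<noteq> 0"
    and iff: "\<And>r s t. on_space X r s t \<longleftrightarrow> s = a * r \<and> t = c * s"
  shows "face_E 2 0 X = line c" "face_E 2 1 X = line (c * a)" "face_E 2 2 X = line a"
    "\<forall>i\<le>2. degenerate 1 (face_N 2 i X)"
proof -
  note F = faces_in_plane[OF X] and P = on_plane_faces[OF X]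
  have "(\<exists>t. r = a * t) \<longleftrightarrow> True" for r
    using ac by (auto intro!: exI[of _ "inverse a * r"] simp flip: mult.assoc)
  then show "face_E 2 0 X = line c"
    by (intro on_plane_inject[OF F(1) line_Lset]) (simp_all add: P on_line iff)
  show "face_E 2 1 X = line (c * a)"
    by (intro on_plane_inject[OF F(1) line_Lset]) (simp_all add: P on_line iff mult.assoc)
  show "face_E 2 2 X = line a"
    by (intro on_plane_inject[OF F(1) line_Lset]) (simp_all add: P on_line iff)
  show "\<forall>i\<le>2. degenerate 1 (face_N 2 i X)"
    unfolding all_le_2 using ac by (intro conjI degenerate_planeI F) (auto simp: P iff)
qed

text \<open>Dually to a line, every projection is the whole plane, and the three sections are lines. The sign
in \<open>- (c * a)\<close> is the origin of the quotient by \<open>{1, -1}\<close>.\<close>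

lemma faces_of_plane:
  fixes X :: "'a::division_ring mclass"
  assumes X: "X \<in> Lset 3" and ac: "a \<noteq> 0" "c \<noteq> 0"
    and iff: "\<And>r s t. on_space X r s t \<longleftrightarrow> t = c * (s - a * r)"
  shows "face_N 2 0 X = line c" "face_N 2 1 X = line (- (c * a))" "face_N 2 2 X = line a"
    "\<forall>i\<le>2. degenerate 1 (face_E 2 i X)"
proof -
  note F = faces_in_plane[OF X] and P = on_plane_faces[OF X]
  show "face_N 2 0 X = line c"
    by (intro on_plane_inject[OF F(2) line_Lset]) (simp_all add: P on_line iff)
  show "face_N 2 1 X = line (- (c * a))"
    by (intro on_plane_inject[OF F(2) line_Lset]) (simp_all add: P on_line iff mult.assoc)
  show "face_N 2 2 X = line a"
    by (intro on_plane_inject[OF F(2) line_Lset]) (use ac in \<open>auto simp: P on_line iff\<close>)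
  have full: "\<exists>t. on_space X t r s" "\<exists>t. on_space X r t s" "\<exists>t. on_space X r s t" for r s
  proof -
    have "a * (inverse a * w) = w" "c * (inverse c * w) = w" for w
      using ac by (simp_all flip: mult.assoc)
    then have "on_space X (inverse a * (r - inverse c * s)) r s" "on_space X r (a * r + inverse c * s) s"
        "on_space X r s (c * (s - a * r))"
      unfolding iff by simp_all
    then show "\<exists>t. on_space X t r s" "\<exists>t. on_space X r t s" "\<exists>t. on_space X r s t"
      by blast+
  qed
  show "\<forall>i\<le>2. degenerate 1 (face_E 2 i X)"
    unfolding all_le_2 by (intro conjI degenerate_planeI F) (simp_all add: P full)
qed

lemma ex_space_line:
  fixes a c :: "'a::division_ring"
  shows "\<exists>X :: 'a mclass. X \<in> Lset 3 \<and> (\<forall>r s t. on_space X r s t \<longleftrightarrow> s = a * r \<and> t = c * s)"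
proof (intro exI conjI allI)
  let ?X = "kernel_class 2 3 (\<lambda>i j. (if i = 0 then [a, -1, 0] else [0, c, -1]) ! j)"
  show "?X \<in> Lset 3" by (rule kernel_class_Lset)
  show "on_space ?X r s t \<longleftrightarrow> s = a * r \<and> t = c * s" for r s t
    unfolding on_space_def csol_kernel_class
    by (auto simp: pt_def lessThan_Suc numeral_2_eq_2 numeral_3_eq_3 less_Suc_eq)
qed

lemma ex_space_plane:
  fixes a c :: "'a::division_ring"
  shows "\<exists>X :: 'a mclass. X \<in> Lset 3 \<and> (\<forall>r s t. on_space X r s t \<longleftrightarrow> t = c * (s - a * r))"
proof (intro exI conjI allI)
  let ?X = "kernel_class 1 3 (\<lambda>_ j. [- (c * a), c, -1] ! j)"
  show "?X \<in> Lset 3" by (rule kernel_class_Lset)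
  show "on_space ?X r s t \<longleftrightarrow> t = c * (s - a * r)" for r s t
    unfolding on_space_def csol_kernel_class
    by (auto simp: pt_def lessThan_Suc numeral_2_eq_2 numeral_3_eq_3 algebra_simps)
qed

text \<open>If a subspace \<open>X\<close> is not flat at any index, then no axis lies in \<open>X\<close> and every coordinate takes
nonzero values on \<open>X\<close>. If the section by \<open>x\<^sub>2 = 0\<close> vanishes, \<open>X\<close> is spanned by a single vector, all of
whose coordinates must be nonzero. Otherwise the section contains some \<open>(1, a, 0)\<close> with \<open>a \<noteq> 0\<close>;
subtracting a multiple of it from a vector with \<open>x\<^sub>2 \<noteq> 0\<close> gives some \<open>(0, 1, c)\<close>, and these two
vectors span \<open>X\<close>, since no vector of the third axis is in \<open>X\<close>.\<close>

lemma space_cases: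
  fixes X :: "'a::division_ring mclass"
  assumes X: "X \<in> Lset 3"
  obtains "degenerate 2 X"
  | (line) a c where "a \<noteq> 0" "c \<noteq> 0"
      "face_E 2 0 X = line c" "face_E 2 1 X = line (c * a)" "face_E 2 2 X = line a"
      "\<forall>i\<le>2. degenerate 1 (face_N 2 i X)"
  | (plane) a c where "a \<noteq> 0" "c \<noteq> 0"
      "face_N 2 0 X = line c" "face_N 2 1 X = line (- (c * a))" "face_N 2 2 X = line a"
      "\<forall>i\<le>2. degenerate 1 (face_E 2 i X)"
proof (cases "degenerate 2 X")
  case False
  then have nf: "\<not> flat i (csol X)" if "i \<le> 2" for i
    using that X by (auto simp: degenerate_iff_flat numeral_3_eq_3)
  obtain x\<^sub>0 y\<^sub>0 z\<^sub>0 where n0: "on_space X x\<^sub>0 y\<^sub>0 z\<^sub>0" "\<not> on_space X 0 y\<^sub>0 z\<^sub>0"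
    using nf[of 0] unfolding flat_space[OF X] by auto
  obtain x\<^sub>1 y\<^sub>1 z\<^sub>1 where n1: "on_space X x\<^sub>1 y\<^sub>1 z\<^sub>1" "\<not> on_space X x\<^sub>1 0 z\<^sub>1"
    using nf[of "Suc 0"] unfolding flat_space[OF X] by auto
  obtain x\<^sub>2 y\<^sub>2 z\<^sub>2 where n2: "on_space X x\<^sub>2 y\<^sub>2 z\<^sub>2" "\<not> on_space X x\<^sub>2 y\<^sub>2 0"
    using nf[of 2] unfolding flat_space[OF X] by auto
  have nz: "x\<^sub>0 \<noteq> 0" "y\<^sub>1 \<noteq> 0" "z\<^sub>2 \<noteq> 0" using n0 n1 n2 by auto
  \<comment> \<open>No coordinate axis lies in \<open>X\<close>.\<close>
  have ax0: "w = 0" if "on_space X w 0 0" for w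
  proof (rule ccontr)
    assume "w \<noteq> 0"
    then have "on_space X x\<^sub>0 0 0"
      using on_space_scale[OF X that, of "inverse w * x\<^sub>0"] by (simp flip: mult.assoc)
    then show False using on_space_diff[OF X n0(1), of x\<^sub>0 0 0] n0(2) by simp
  qed
  have ax1: "w = 0" if "on_space X 0 w 0" for w
  proof (rule ccontr)
    assume "w \<noteq> 0"
    then have "on_space X 0 y\<^sub>1 0"
      using on_space_scale[OF X that, of "inverse w * y\<^sub>1"] by (simp flip: mult.assoc)
    then show False using on_space_diff[OF X n1(1), of 0 y\<^sub>1 0] n1(2) by simp
  qed
  have ax2: "w = 0" if "on_space X 0 0 w" for w
  proof (rule ccontr)
    assume "w \<noteq> 0"
    then have "on_space X 0 0 z\<^sub>2"
      using on_space_scale[OF X that, of "inverse w * z\<^sub>2"] by (simp flip: mult.assoc)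
    then show False using on_space_diff[OF X n2(1), of 0 0 z\<^sub>2] n2(2) by simp
  qed
  show ?thesis
  proof (cases "\<exists>u v. on_space X u v 0 \<and> (u \<noteq> 0 \<or> v \<noteq> 0)")
    case False
    define u v where "u = x\<^sub>2 * inverse z\<^sub>2" and "v = y\<^sub>2 * inverse z\<^sub>2"
    have 1: "on_space X u v 1"
      using on_space_scale[OF X n2(1), of "inverse z\<^sub>2"] nz by (simp add: u_def v_def)
    have iff: "on_space X r s t \<longleftrightarrow> r = u * t \<and> s = v * t" for r s t
    proof
      assume "on_space X r s t"
      then have "on_space X (r - u * t) (s - v * t) 0"
        using on_space_diff[OF X _ on_space_scale[OF X 1, of t], of r s t] by simp
      then show "r = u * t \<and> s = v * t" using False by fastforce
    qed (use on_space_scale[OF X 1, of t] in simp)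
    have uv: "u \<noteq> 0" "v \<noteq> 0" using n0 n1 iff nz by auto
    define a c where "a = v * inverse u" and "c = inverse v"
    have ac: "a \<noteq> 0" "c \<noteq> 0" using uv by (auto simp: a_def c_def)
    have "on_space X r s t \<longleftrightarrow> s = a * r \<and> t = c * s" for r s t
    proof -
      have "a * (u * t) = v * t" "c * (v * t) = t"
        using uv by (simp_all add: a_def c_def mult.assoc) (simp_all flip: mult.assoc)
      moreover have "u * (c * (a * r)) = r" "v * (c * (a * r)) = a * r"
        using uv by (simp_all add: a_def c_def flip: mult.assoc)
      ultimately show ?thesis unfolding iff by auto
    qed
    then show ?thesis using line[OF ac] faces_of_line[OF X ac] by blast
  next
    case True
    then obtain u v where uv: "on_space X u v 0" "u \<noteq> 0 \<or> v \<noteq> 0" by blast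
    have uv0: "u \<noteq> 0" "v \<noteq> 0" using uv ax0 ax1 by auto
    define a where "a = v * inverse u"
    have a: "a \<noteq> 0" using uv0 by (simp add: a_def)
    have 1: "on_space X 1 a 0"
      using on_space_scale[OF X uv(1), of "inverse u"] uv0 by (simp add: a_def)
    define d where "d = y\<^sub>2 - a * x\<^sub>2"
    have 2: "on_space X 0 d z\<^sub>2"
      using on_space_diff[OF X n2(1) on_space_scale[OF X 1, of x\<^sub>2]] by (simp add: d_def)
    have d: "d \<noteq> 0" using 2 ax2 nz by auto
    define c where "c = z\<^sub>2 * inverse d"
    have c: "c \<noteq> 0" using nz d by (simp add: c_def)
    have 3: "on_space X 0 1 c"
      using on_space_scale[OF X 2, of "inverse d"] d by (simp add: c_def)
    have "on_space X r s t \<longleftrightarrow> t = c * (s - a * r)" for r s t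
    proof -
      have *: "on_space X r s (c * (s - a * r))"
        using on_space_diff[OF X on_space_scale[OF X 1, of r] on_space_scale[OF X 3, of "a * r - s"]]
        by (simp add: algebra_simps)
      show ?thesis
      proof
        assume "on_space X r s t"
        then have "on_space X 0 0 (t - c * (s - a * r))" using on_space_diff[OF X _ *] by force
        then show "t = c * (s - a * r)" using ax2 by fastforce
      qed (use * in simp)
    qed
    then show ?thesis using plane[OF a c] faces_of_plane[OF X a c] by blast
  qed
qed (rule that(1))

section \<open>The complex in low degrees\<close>

lemma Q_grp_simps:
  "Q_grp 0 = free_Abelian_group (Lset 1)" "Q_grp 1 = free_Abelian_group (Lset 2)"
  "Q_grp 2 = free_Abelian_group (Lset 3)"
  by (simp_all add: Q_grp_def numeral_2_eq_2 numeral_3_eq_3)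

lemma comm_group_Q_grp: "comm_group (Q_grp n)"
  unfolding Q_grp_def by (rule abelian_free_Abelian_group)

lemma subgroup_M_sub: "subgroup (M_sub n) (Q_grp n)"
proof -
  interpret comm_group "Q_grp n" by (rule comm_group_Q_grp)
  show ?thesis
    unfolding M_sub_def by (rule generate_is_subgroup) (auto simp: Q_grp_def degenerate_def)
qed

lemma normal_M_sub: "M_sub n \<lhd> Q_grp n"
  using subgroup_M_sub comm_group.normal_iff_subgroup[OF comm_group_Q_grp] by blast

lemma comm_group_C_grp: "comm_group (C_grp n)"
  unfolding C_grp_def by (rule comm_group.abelian_FactGroup[OF comm_group_Q_grp subgroup_M_sub])

lemma M_sub_simps: "M_sub 0 = {0}"
  "M_sub 1 = generate (Q_grp 1) (frag_of ` {X. degenerate 1 X})"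
  "M_sub 2 = generate (Q_grp 2) (frag_of ` {X. degenerate 2 X})"
proof -
  interpret comm_group "Q_grp 0 :: 'a chain monoid" by (rule comm_group_Q_grp)
  show "M_sub 0 = ({0} :: 'a chain set)"
    unfolding M_sub_def by (simp add: generate_empty) (simp add: Q_grp_def)
qed (simp_all add: M_sub_def)

lemma degenerate_in_M_sub: "degenerate 1 X \<Longrightarrow> frag_of X \<in> M_sub 1"
  unfolding M_sub_simps by (auto intro: generate.incl)

lemma M_sub_1_add:
  assumes "x \<in> M_sub 1" "y \<in> M_sub 1"
  shows "x + y \<in> M_sub 1"
  using subgroup.m_closed[OF subgroup_M_sub assms] by (simp add: Q_grp_simps)

lemma M_sub_1_uminus:
  assumes "x \<in> M_sub 1"
  shows "- x \<in> M_sub 1"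
  using subgroup.m_inv_closed[OF subgroup_M_sub assms] subgroup.mem_carrier[OF subgroup_M_sub assms]
  by (simp add: Q_grp_simps)

lemma M_sub_1_zero: "0 \<in> M_sub 1"
  using subgroup.one_closed[OF subgroup_M_sub[of 1]] by (simp add: Q_grp_simps)

lemma M_sub_1_diff: "x \<in> M_sub 1 \<Longrightarrow> y \<in> M_sub 1 \<Longrightarrow> x - y \<in> M_sub 1"
  using M_sub_1_add[OF _ M_sub_1_uminus, of x y] by simp

lemmas M_sub_1_closed = M_sub_1_zero M_sub_1_add M_sub_1_uminus M_sub_1_diff

lemma bd_Q_add: "bd_Q n (x + y) = bd_Q n x + bd_Q n y" if "n \<ge> 0"
  using that by (simp add: bd_Q_def frag_extend_add)

lemma bd_Q_2_of: "bd_Q 2 (frag_of X) =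
   (frag_of (face_E 2 0 X) - frag_of (face_N 2 0 X)) - (frag_of (face_E 2 1 X) - frag_of (face_N 2 1 X))
   + (frag_of (face_E 2 2 X) - frag_of (face_N 2 2 X))"
  by (simp add: bd_Q_def numeral_2_eq_2)

lemma bd_Q_2_closed:
  assumes "c \<in> carrier (Q_grp 2)"
  shows "bd_Q 2 c \<in> carrier (Q_grp 1)"
proof -
  have "Poly_Mapping.keys (\<Sum>i\<le>nat 2. frag_cmul ((-1) ^ i)
      (frag_of (face_E (nat 2) i X) - frag_of (face_N (nat 2) i X))) \<subseteq> Lset 2"
    if "X \<in> Lset 3" for X :: "'a mclass"
  proof (rule subset_trans[OF keys_sum], rule UN_least)
    fix i assume "i \<in> {..nat 2}"
    then have "face_E 2 i X \<in> Lset 2" "face_N 2 i X \<in> Lset 2"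
      using that faces_in_plane[of X i] by auto
    then show "Poly_Mapping.keys (frag_cmul ((-1) ^ i)
        (frag_of (face_E (nat 2) i X) - frag_of (face_N (nat 2) i X))) \<subseteq> Lset 2"
      using keys_diff[of "frag_of (face_E 2 i X)" "frag_of (face_N 2 i X)"] by auto
  qed
  then show ?thesis
    using assms keys_frag_extend unfolding Q_grp_simps bd_Q_def by fastforce
qed

lemma bd_Q_2_hom: "bd_Q 2 \<in> hom (Q_grp 2) (Q_grp 1)"
  by (rule homI) (use bd_Q_2_closed in \<open>auto simp: Q_grp_simps bd_Q_add\<close>)

text \<open>This makes the boundary well defined on the quotient by degenerate chains.\<close>

lemma bd_Q_2_M_sub:
  fixes m :: "'a::division_ring chain"
  assumes "m \<in> M_sub 2"
  shows "bd_Q 2 m \<in> M_sub 1"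
proof -
  have deg: "bd_Q 2 (frag_of X) \<in> M_sub 1" if X: "degenerate 2 X" for X :: "'a mclass"
  proof -
    have L: "X \<in> Lset 3" using X by (simp add: degenerate_def)
    obtain i where i: "i \<le> 2" "face_E 2 i X = face_N 2 i X" "flat i (csol X)"
      using X faces_eq_iff_flat[of X 2] by (auto simp: degenerate_def)
    have M: "frag_of (face_E 2 j X) - frag_of (face_N 2 j X) \<in> M_sub 1" if "j \<le> 2" for j
    proof (cases "j = i")
      case True
      then show ?thesis using i by (simp add: M_sub_1_closed)
    next
      case False
      then show ?thesis
        using degenerate_faces[of X 1 i j] L i that
        by (intro M_sub_1_closed degenerate_in_M_sub) (simp_all add: numeral_3_eq_3 numeral_2_eq_2)
    qed
    show ?thesis
      unfolding bd_Q_2_of by (intro M_sub_1_closed M) simp_all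
  qed
  show ?thesis
    using assms unfolding M_sub_simps(3)
  proof induction
    case one
    then show ?case by (simp add: Q_grp_simps bd_Q_def M_sub_1_closed)
  next
    case (incl h)
    then show ?case using deg by auto
  next
    case (inv h)
    then obtain X where X: "degenerate 2 X" "h = frag_of X" by auto
    then have "inv\<^bsub>Q_grp 2\<^esub> h = - frag_of X"
      by (simp add: Q_grp_simps degenerate_def)
    then have "bd_Q 2 (inv\<^bsub>Q_grp 2\<^esub> h) = - bd_Q 2 (frag_of X)"
      by (simp add: bd_Q_def frag_extend_minus)
    then show ?case using deg[OF X(1)] by (simp add: M_sub_1_closed)
  next
    case (eng h1 h2)
    then show ?case by (simp add: Q_grp_simps bd_Q_add M_sub_1_closed)
  qed
qed

text \<open>A degenerate generator is flat at both indices, so its two differences of faces vanish separately. For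
a line of nonzero slope both projections are all of \<open>k\<close> and both sections are zero, so the two
differences cancel.\<close>

lemma bd_Q_1_zero:
  fixes c :: "'a::division_ring chain"
  assumes "c \<in> carrier (Q_grp 1)"
  shows "bd_Q 1 c = 0"
proof -
  have "(\<Sum>i\<le>nat 1. frag_cmul ((-1) ^ i) (frag_of (face_E (nat 1) i X) - frag_of (face_N (nat 1) i X))) = 0"
    if X: "X \<in> Lset 2" for X :: "'a mclass"
  proof -
    have X': "X \<in> Lset (Suc (Suc 0))" using X by (simp add: numeral_2_eq_2)
    have "frag_of (face_E 1 0 X) - frag_of (face_N 1 0 X) = frag_of (face_E 1 1 X) - frag_of (face_N 1 1 X)"
      using X
    proof (cases rule: plane_cases)
      case 1
      then have "face_E 1 0 X = face_N 1 0 X" "face_E 1 1 X = face_N 1 1 X"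
        using faces_eq_iff_flat[OF X'] unfolding degenerate_plane_iff by auto
      then show ?thesis by simp
    next
      case (2 a)
      have iff: "f \<in> csol X \<longleftrightarrow> f 1 = a * f 0" for f
        using on_plane_iff[OF X] by (simp add: 2 on_line)
      have ex: "\<exists>t. r = a * t" for r
        using 2(1) by (intro exI[of _ "inverse a * r"]) (simp flip: mult.assoc)
      have "face_E (Suc 0) 0 X = face_E (Suc 0) (Suc 0) X"
        by (rule csol_inject[OF face_E_sol(1)[OF X'] face_E_sol(1)[OF X']])
          (use ex in \<open>simp_all add: face_E_sol(2)[OF X'] iff ins_def\<close>)
      moreover have "face_N (Suc 0) 0 X = face_N (Suc 0) (Suc 0) X"
        by (rule csol_inject[OF face_N_sol(1)[OF X'] face_N_sol(1)[OF X']])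
          (use 2(1) in \<open>auto simp: face_N_sol(2)[OF X'] iff ins_def\<close>)
      ultimately show ?thesis by simp
    qed
    then show ?thesis by simp
  qed
  then show ?thesis
    using assms unfolding Q_grp_simps bd_Q_def by (auto intro!: frag_extend_eq_0)
qed

text \<open>All of \<open>C\<^sub>1\<close> consists of cycles, hence \<open>H\<^sub>1\<close> is \<open>C\<^sub>1\<close> modulo boundaries.\<close>

lemma kernel_bd_C_1: "kernel (C_grp 1) (C_grp 0) (bd_C 1) = carrier (C_grp 1 :: 'a::division_ring chain set monoid)"
proof -
  interpret N: normal "M_sub 1" "Q_grp 1 :: 'a chain monoid" by (rule normal_M_sub)
  have "bd_C 1 X = M_sub 0" if "X \<in> carrier (C_grp 1)" for X :: "'a chain set"
  proof -
    obtain c where c: "c \<in> carrier (Q_grp 1)" "X = M_sub 1 #>\<^bsub>Q_grp 1\<^esub> c"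
      using \<open>X \<in> _\<close> by (auto simp: C_grp_def carrier_FactGroup)
    have "X \<subseteq> carrier (Q_grp 1)" "c \<in> X"
      using c N.r_coset_subset_G N.subset N.rcos_self N.subgroup_axioms by auto
    then have "(\<Union>c\<in>X. M_sub 0 #>\<^bsub>Q_grp 0\<^esub> bd_Q 1 c) = (\<Union>c\<in>X. M_sub 0 #>\<^bsub>Q_grp 0\<^esub> 0)"
      by (intro SUP_cong) (auto simp: bd_Q_1_zero)
    also have "\<dots> = M_sub 0"
      using \<open>c \<in> X\<close> by (auto simp: M_sub_simps r_coset_def Q_grp_simps)
    finally show ?thesis by (simp add: bd_C_def)
  qed
  then show ?thesis by (auto simp: kernel_def C_grp_def)
qed

lemma bd_C_2_coset:
  assumes c: "c \<in> carrier (Q_grp 2)"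
  shows "bd_C 2 (M_sub 2 #>\<^bsub>Q_grp 2\<^esub> c) = M_sub 1 #>\<^bsub>Q_grp 1\<^esub> bd_Q 2 (c :: 'a::division_ring chain)"
proof -
  interpret N: normal "M_sub 1" "Q_grp 1 :: 'a chain monoid" by (rule normal_M_sub)
  have 1: "M_sub 1 #>\<^bsub>Q_grp 1\<^esub> bd_Q 2 d = M_sub 1 #>\<^bsub>Q_grp 1\<^esub> bd_Q 2 c"
    if d: "d \<in> M_sub 2 #>\<^bsub>Q_grp 2\<^esub> c" for d
  proof -
    obtain m where m: "m \<in> M_sub 2" "d = m + c"
      using d by (auto simp: r_coset_def Q_grp_simps)
    then have bd: "bd_Q 2 d = bd_Q 2 m \<otimes>\<^bsub>Q_grp 1\<^esub> bd_Q 2 c"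
      by (simp add: bd_Q_add Q_grp_simps)
    have "bd_Q 2 d \<in> M_sub 1 #>\<^bsub>Q_grp 1\<^esub> bd_Q 2 c"
      unfolding bd using bd_Q_2_M_sub[OF m(1)] by (auto simp: r_coset_def)
    then show ?thesis
      using N.repr_independence[OF _ bd_Q_2_closed[OF c] N.subgroup_axioms] by simp
  qed
  have "c \<in> M_sub 2 #>\<^bsub>Q_grp 2\<^esub> c"
    using group.rcos_self[OF _ c subgroup_M_sub] comm_group_Q_grp comm_group.axioms(2) by blast
  moreover have "(\<Union>d\<in>M_sub 2 #>\<^bsub>Q_grp 2\<^esub> c. M_sub 1 #>\<^bsub>Q_grp 1\<^esub> bd_Q 2 d)
      = (\<Union>d\<in>M_sub 2 #>\<^bsub>Q_grp 2\<^esub> c. M_sub 1 #>\<^bsub>Q_grp 1\<^esub> bd_Q 2 c)"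
    by (intro SUP_cong refl 1)
  ultimately show ?thesis unfolding bd_C_def by auto
qed

definition boundaries :: "'a::division_ring chain set set" where
  "boundaries = bd_C 2 ` carrier (C_grp 2)"

lemma boundaries_eq:
  "boundaries = (\<lambda>c. M_sub 1 #>\<^bsub>Q_grp 1\<^esub> bd_Q 2 c) ` carrier (Q_grp 2)"
  unfolding boundaries_def
  by (auto simp: C_grp_def carrier_FactGroup image_image bd_C_2_coset intro!: image_cong)

lemma H_grp_1: "H_grp 1 = C_grp 1 Mod (boundaries :: 'a::division_ring chain set set)"
  by (simp add: H_grp_def boundaries_def kernel_bd_C_1)

lemma subgroup_boundaries: "subgroup boundaries (C_grp 1)"
proof -
  have "(\<lambda>c. M_sub 1 #>\<^bsub>Q_grp 1\<^esub> bd_Q 2 c) \<in> hom (Q_grp 2) (C_grp 1)"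
    using hom_compose[OF bd_Q_2_hom normal.r_coset_hom_Mod[OF normal_M_sub]]
    by (simp add: C_grp_def comp_def)
  then interpret group_hom "Q_grp 2" "C_grp 1" "\<lambda>c. M_sub 1 #>\<^bsub>Q_grp 1\<^esub> bd_Q 2 c"
    by (intro group_hom.intro group_hom_axioms.intro comm_group.axioms(2) comm_group_Q_grp
        comm_group_C_grp)
  show ?thesis unfolding boundaries_eq by (rule img_is_subgroup)
qed

lemma normal_boundaries: "boundaries \<lhd> C_grp 1"
  using subgroup_boundaries comm_group.normal_iff_subgroup[OF comm_group_C_grp] by blast

lemma comm_group_H_grp_1: "comm_group (H_grp 1 :: 'a::division_ring chain set set monoid)"
  unfolding H_grp_1 by (rule comm_group.abelian_FactGroup[OF comm_group_C_grp subgroup_boundaries])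

text \<open>Relations are written without subtraction, so that a homomorphism into a multiplicatively written
group can be applied to both sides directly; \<open>m\<close> collects the degenerate sections.\<close>

lemma bd_Q_2_of_line:
  fixes X :: "'a::division_ring mclass"
  assumes "face_E 2 0 X = line c" "face_E 2 1 X = line (c * a)" "face_E 2 2 X = line a"
    and N: "\<forall>i\<le>2. degenerate 1 (face_N 2 i X)"
  shows "\<exists>m\<in>M_sub 1. bd_Q 2 (frag_of X) + frag_of (line (c * a)) = frag_of (line c) + frag_of (line a) + m"
proof
  let ?m = "frag_of (face_N 2 1 X) - frag_of (face_N 2 0 X) - frag_of (face_N 2 2 X)"
  show "?m \<in> M_sub 1"
    by (intro M_sub_1_closed degenerate_in_M_sub N[rule_format]) simp_all
  show "bd_Q 2 (frag_of X) + frag_of (line (c * a)) = frag_of (line c) + frag_of (line a) + ?m"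
    unfolding bd_Q_2_of assms(1-3) by simp
qed

lemma bd_Q_2_of_plane:
  fixes X :: "'a::division_ring mclass"
  assumes "face_N 2 0 X = line c" "face_N 2 1 X = line (- (c * a))" "face_N 2 2 X = line a"
    and E: "\<forall>i\<le>2. degenerate 1 (face_E 2 i X)"
  shows "\<exists>m\<in>M_sub 1.
    bd_Q 2 (frag_of X) + (frag_of (line c) + frag_of (line a)) = frag_of (line (- (c * a))) + m"
proof
  let ?m = "frag_of (face_E 2 0 X) - frag_of (face_E 2 1 X) + frag_of (face_E 2 2 X)"
  show "?m \<in> M_sub 1"
    by (intro M_sub_1_closed degenerate_in_M_sub E[rule_format]) simp_all
  show "bd_Q 2 (frag_of X) + (frag_of (line c) + frag_of (line a)) = frag_of (line (- (c * a))) + ?m"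
    unfolding bd_Q_2_of assms(1-3) by simp
qed

section \<open>Group-theoretic preliminaries\<close>

text \<open>Commutators are mapped to commutators, which are trivial in an abelian group.\<close>

lemma (in group_hom) derived_subset_kernel:
  assumes "comm_group H"
  shows "derived G (carrier G) \<subseteq> kernel G H h"
  unfolding derived_def
proof (rule G.generate_subgroup_incl[OF _ subgroup_kernel])
  interpret H: comm_group H by (rule assms)
  have "h (x \<otimes>\<^bsub>G\<^esub> y \<otimes>\<^bsub>G\<^esub> inv\<^bsub>G\<^esub> x \<otimes>\<^bsub>G\<^esub> inv\<^bsub>G\<^esub> y) = \<one>\<^bsub>H\<^esub>"
    if xy: "x \<in> carrier G" "y \<in> carrier G" for x y
  proof -
    have "h (x \<otimes>\<^bsub>G\<^esub> y \<otimes>\<^bsub>G\<^esub> inv\<^bsub>G\<^esub> x \<otimes>\<^bsub>G\<^esub> inv\<^bsub>G\<^esub> y)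
        = h x \<otimes>\<^bsub>H\<^esub> h y \<otimes>\<^bsub>H\<^esub> inv\<^bsub>H\<^esub> h x \<otimes>\<^bsub>H\<^esub> inv\<^bsub>H\<^esub> h y"
      using xy by simp
    also have "\<dots> = h y \<otimes>\<^bsub>H\<^esub> h x \<otimes>\<^bsub>H\<^esub> inv\<^bsub>H\<^esub> h x \<otimes>\<^bsub>H\<^esub> inv\<^bsub>H\<^esub> h y"
      using xy by (simp add: H.m_comm)
    also have "\<dots> = \<one>\<^bsub>H\<^esub>" using xy by (simp add: H.m_assoc)
    finally show ?thesis .
  qed
  then show "derived_set G (carrier G) \<subseteq> kernel G H h" by (auto simp: kernel_def)
qed

lemma hom_free_Abelian_group_eqI:
  assumes "group G" and h: "h \<in> hom (free_Abelian_group S) G" "k \<in> hom (free_Abelian_group S) G"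
    and gen: "\<And>x. x \<in> S \<Longrightarrow> h (frag_of x) = k (frag_of x)"
    and c: "c \<in> carrier (free_Abelian_group S)"
  shows "h c = k c"
proof -
  interpret h: group_hom "free_Abelian_group S" G h
    using assms by (intro group_hom.intro group_hom_axioms.intro) auto
  interpret k: group_hom "free_Abelian_group S" G k
    using assms by (intro group_hom.intro group_hom_axioms.intro) auto
  show ?thesis
  proof (rule free_Abelian_group_induct[where P = "\<lambda>c. h c = k c" and S = S and x = c])
    show "Poly_Mapping.keys c \<subseteq> S" using c by simp
    show "h 0 = k 0" using h.hom_one k.hom_one by simp
    fix x y
    assume xy: "Poly_Mapping.keys x \<subseteq> S" "Poly_Mapping.keys y \<subseteq> S" "h x = k x" "h y = k y"
    let ?F = "free_Abelian_group S"
    have "h (x \<otimes>\<^bsub>?F\<^esub> inv\<^bsub>?F\<^esub> y) = h x \<otimes>\<^bsub>G\<^esub> inv\<^bsub>G\<^esub> h y"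
      "k (x \<otimes>\<^bsub>?F\<^esub> inv\<^bsub>?F\<^esub> y) = k x \<otimes>\<^bsub>G\<^esub> inv\<^bsub>G\<^esub> k y"
      using xy(1,2) by (simp_all del: mult_free_Abelian_group inv_free_Abelian_group
          add: h.G.inv_closed[unfolded carrier_free_Abelian_group_iff])
    then show "h (x - y) = k (x - y)" using xy by simp
  qed (rule gen)
qed

section \<open>The abelianized unit group modulo sign\<close>

lemma group_mult_group: "group (mult_group :: 'k::division_ring monoid)"
proof (rule groupI)
  fix x :: 'k assume "x \<in> carrier mult_group"
  then show "\<exists>y\<in>carrier mult_group. y \<otimes>\<^bsub>mult_group\<^esub> x = \<one>\<^bsub>mult_group\<^esub>"
    by (intro bexI[of _ "inverse x"]) (auto simp: mult_group_def)
qed (auto simp: mult_group_def mult.assoc)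

lemma mult_group_simps: "carrier mult_group = UNIV - {0}" "x \<otimes>\<^bsub>mult_group\<^esub> y = x * y"
    "\<one>\<^bsub>mult_group\<^esub> = 1"
  by (simp_all add: mult_group_def)

lemma comm_group_abelianization: "group G \<Longrightarrow> comm_group (abelianization G)"
  unfolding abelianization_def by (rule group.derived_quot_is_comm_group)

lemma ab_class_hom: "group G \<Longrightarrow> ab_class G \<in> hom G (abelianization G)"
  unfolding abelianization_def ab_class_def
  using normal.r_coset_hom_Mod[OF group.derived_self_is_normal] by blast

lemma carrier_abelianization: "carrier (abelianization G) = ab_class G ` carrier G"
  unfolding abelianization_def ab_class_def carrier_FactGroup ..

definition signs :: "'k::division_ring set set" where
  "signs = ab_class mult_group ` {1, -1}"

lemma subgroup_signs: "subgroup signs (abelianization (mult_group :: 'k::division_ring monoid))"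
proof -
  interpret group_hom "mult_group :: 'k monoid" "abelianization mult_group" "ab_class mult_group"
    by (intro group_hom.intro group_hom_axioms.intro group_mult_group ab_class_hom
        comm_group.axioms(2)[OF comm_group_abelianization])
  have "subgroup {1, -1 :: 'k} mult_group"
  proof (rule G.subgroupI)
    fix a :: 'k assume "a \<in> {1, -1}"
    then have "inv\<^bsub>mult_group\<^esub> a = a"
      by (intro G.inv_equality) (auto simp: mult_group_simps)
    with \<open>a \<in> {1, -1}\<close> show "inv\<^bsub>mult_group\<^esub> a \<in> {1, -1}" by simp
  qed (auto simp: mult_group_simps)
  then show ?thesis unfolding signs_def by (rule subgroup_img_is_subgroup)
qed

definition units_mod_sign :: "'k::division_ring set set monoid" where
  "units_mod_sign = abelianization mult_group Mod signs"

definition unit_class :: "'k::division_ring \<Rightarrow> 'k set set" where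
  "unit_class a = signs #>\<^bsub>abelianization mult_group\<^esub> ab_class mult_group a"

lemma normal_signs: "signs \<lhd> abelianization (mult_group :: 'k::division_ring monoid)"
  using subgroup_signs comm_group.normal_iff_subgroup[OF comm_group_abelianization[OF group_mult_group]]
  by blast

lemma comm_group_units_mod_sign: "comm_group (units_mod_sign :: 'k::division_ring set set monoid)"
  unfolding units_mod_sign_def
  by (rule comm_group.abelian_FactGroup[OF comm_group_abelianization[OF group_mult_group] subgroup_signs])

lemma unit_class_hom: "unit_class \<in> hom (mult_group :: 'k::division_ring monoid) units_mod_sign"
  using hom_compose[OF ab_class_hom[OF group_mult_group] normal.r_coset_hom_Mod[OF normal_signs]]
  by (simp add: units_mod_sign_def unit_class_def[abs_def] comp_def)

lemma carrier_units_mod_sign: "carrier units_mod_sign = unit_class ` (carrier mult_group :: 'k::division_ring set)"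
  unfolding units_mod_sign_def unit_class_def carrier_FactGroup carrier_abelianization image_image ..

lemma unit_class_mult: "a \<noteq> 0 \<Longrightarrow> b \<noteq> 0 \<Longrightarrow> unit_class (a * b) = unit_class a \<otimes>\<^bsub>units_mod_sign\<^esub> unit_class b"
  using hom_mult[OF unit_class_hom, of a b] by (simp add: mult_group_simps)

lemma unit_class_closed: "a \<noteq> 0 \<Longrightarrow> unit_class a \<in> carrier units_mod_sign"
  by (simp add: carrier_units_mod_sign mult_group_simps)

lemma unit_class_minus_one: "unit_class (- 1 :: 'k::division_ring) = \<one>\<^bsub>units_mod_sign\<^esub>"
proof -
  interpret A: comm_group "abelianization (mult_group :: 'k monoid)"
    by (rule comm_group_abelianization[OF group_mult_group])
  have "ab_class mult_group (- 1 :: 'k) \<in> carrier (abelianization mult_group)"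
    by (auto simp: carrier_abelianization mult_group_simps)
  then show ?thesis
    unfolding unit_class_def units_mod_sign_def one_FactGroup
    using subgroup_signs by (intro A.coset_join2) (auto simp: signs_def)
qed

text \<open>A homomorphism to an abelian group factors through the abelianization, and if it kills \<open>-1\<close>, also
through the quotient by the classes of \<open>1\<close> and \<open>-1\<close>.\<close>

lemma units_universal:
  assumes H: "comm_group H" and f: "f \<in> hom (mult_group :: 'k::division_ring monoid) H"
    and m1: "f (- 1) = \<one>\<^bsub>H\<^esub>"
  obtains g where "g \<in> hom units_mod_sign H" "\<And>a. a \<noteq> 0 \<Longrightarrow> g (unit_class a) = f a"
proof -
  interpret f: group_hom "mult_group :: 'k monoid" H f
    by (intro group_hom.intro group_hom_axioms.intro group_mult_group comm_group.axioms(2) H f)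
  obtain f' where f': "f' \<in> hom (abelianization mult_group) H"
      "\<And>a. a \<in> carrier mult_group \<Longrightarrow> f' (ab_class mult_group a) = f a"
    unfolding abelianization_def ab_class_def
    using f.FactGroup_universal_kernel[OF f.G.derived_self_is_normal f.derived_subset_kernel[OF H]] by metis
  interpret f': group_hom "abelianization (mult_group :: 'k monoid)" H f'
    by (intro group_hom.intro group_hom_axioms.intro comm_group.axioms(2) H f'(1)
        comm_group_abelianization group_mult_group)
  have "signs \<subseteq> kernel (abelianization mult_group) H f'"
    using f'(2)[of 1] f'(2)[of "-1"] f.hom_one m1
    by (auto simp: signs_def kernel_def carrier_abelianization mult_group_simps)
  then obtain g where g: "g \<in> hom units_mod_sign H"
      "\<And>x. x \<in> carrier (abelianization mult_group) \<Longrightarrow> g (signs #>\<^bsub>abelianization mult_group\<^esub> x) = f' x"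
    unfolding units_mod_sign_def using f'.FactGroup_universal_kernel[OF normal_signs] by metis
  then show ?thesis
    by (intro that[of g]) (auto simp: unit_class_def f'(2) carrier_abelianization mult_group_simps)
qed

section \<open>Homomorphisms out of the first homology group\<close>

text \<open>The homology class of a chain in degree \<open>1\<close>; every such chain is a cycle by \<open>kernel_bd_C_1\<close>.\<close>

definition hclass :: "'a::division_ring chain \<Rightarrow> 'a chain set set" where
  "hclass c = boundaries #>\<^bsub>C_grp 1\<^esub> (M_sub 1 #>\<^bsub>Q_grp 1\<^esub> c)"

lemma hclass_hom: "hclass \<in> hom (Q_grp 1) (H_grp 1 :: 'a::division_ring chain set set monoid)"
proof -
  have "(#>\<^bsub>Q_grp 1\<^esub>) (M_sub 1) \<in> hom (Q_grp 1) (C_grp 1 :: 'a chain set monoid)"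
    unfolding C_grp_def by (rule normal.r_coset_hom_Mod[OF normal_M_sub])
  from hom_compose[OF this normal.r_coset_hom_Mod[OF normal_boundaries]] show ?thesis
    by (simp add: H_grp_1 hclass_def[abs_def] comp_def)
qed

lemma carrier_H_grp_1: "carrier (H_grp 1) = hclass ` carrier (Q_grp 1 :: 'a::division_ring chain monoid)"
  unfolding H_grp_1 carrier_FactGroup hclass_def C_grp_def image_image ..

lemma hclass_add:
  "x \<in> carrier (Q_grp 1) \<Longrightarrow> y \<in> carrier (Q_grp 1) \<Longrightarrow>
    hclass (x + y) = hclass x \<otimes>\<^bsub>H_grp 1\<^esub> hclass y"
  using hom_mult[OF hclass_hom, of x y] by (simp add: Q_grp_simps)

lemma hclass_M_sub:
  assumes "m \<in> M_sub 1"
  shows "hclass m = \<one>\<^bsub>H_grp 1\<^esub>"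
proof -
  have "M_sub 1 #>\<^bsub>Q_grp 1\<^esub> m = M_sub 1"
    using assms subgroup_M_sub comm_group.axioms(2)[OF comm_group_Q_grp]
    by (intro group.coset_join2) (auto intro: subgroup.mem_carrier)
  then have "M_sub 1 #>\<^bsub>Q_grp 1\<^esub> m = \<one>\<^bsub>C_grp 1\<^esub>" by (simp add: C_grp_def)
  moreover interpret C: comm_group "C_grp 1 :: 'a chain set monoid" by (rule comm_group_C_grp)
  have "boundaries #>\<^bsub>C_grp 1\<^esub> \<one>\<^bsub>C_grp 1\<^esub> = (boundaries :: 'a chain set set)"
    using subgroup_boundaries subgroup.subset by (intro C.coset_mult_one) blast
  ultimately show ?thesis by (simp add: hclass_def H_grp_1)
qed

lemma hclass_bd:
  assumes "c \<in> carrier (Q_grp 2)"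
  shows "hclass (bd_Q 2 c) = \<one>\<^bsub>H_grp 1\<^esub>"
proof -
  have "M_sub 1 #>\<^bsub>Q_grp 1\<^esub> bd_Q 2 c \<in> boundaries" using assms by (auto simp: boundaries_eq)
  then show ?thesis
    unfolding hclass_def H_grp_1 one_FactGroup
    using subgroup_boundaries comm_group.axioms(2)[OF comm_group_C_grp]
    by (intro group.coset_join2) (auto intro: subgroup.mem_carrier)
qed

text \<open>The group \<open>H\<^sub>1\<close> is presented by the classes of \<open>L\<^sub>2\<close> as generators, with the degenerate classes and
the boundaries of the generators of \<open>Q\<^sub>2\<close> as relators.\<close>

lemma H_grp_1_universal:
  assumes T: "comm_group T" and f: "f \<in> hom (Q_grp 1 :: 'a::division_ring chain monoid) T"
    and deg: "\<And>X. degenerate 1 X \<Longrightarrow> f (frag_of X) = \<one>\<^bsub>T\<^esub>"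
    and bd: "\<And>X. X \<in> Lset 3 \<Longrightarrow> f (bd_Q 2 (frag_of X)) = \<one>\<^bsub>T\<^esub>"
  obtains g where "g \<in> hom (H_grp 1) T" "\<And>c. c \<in> carrier (Q_grp 1) \<Longrightarrow> g (hclass c) = f c"
proof -
  interpret f: group_hom "Q_grp 1 :: 'a chain monoid" T f
    by (intro group_hom.intro group_hom_axioms.intro comm_group.axioms(2) comm_group_Q_grp T f)
  have "M_sub 1 \<subseteq> kernel (Q_grp 1) T f"
    unfolding M_sub_simps
    by (rule f.G.generate_subgroup_incl[OF _ f.subgroup_kernel])
      (auto simp: kernel_def deg Q_grp_simps degenerate_plane_iff[unfolded One_nat_def])
  then obtain f' where f': "f' \<in> hom (C_grp 1) T"
      "\<And>c. c \<in> carrier (Q_grp 1) \<Longrightarrow> f' (M_sub 1 #>\<^bsub>Q_grp 1\<^esub> c) = f c"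
    using f.FactGroup_universal_kernel[OF normal_M_sub] unfolding C_grp_def by metis
  interpret f': group_hom "C_grp 1 :: 'a chain set monoid" T f'
    by (intro group_hom.intro group_hom_axioms.intro comm_group.axioms(2) comm_group_C_grp T f'(1))
  have "f (bd_Q 2 c) = \<one>\<^bsub>T\<^esub>" if c: "c \<in> carrier (Q_grp 2)" for c
  proof -
    have "(f \<circ> bd_Q 2) c = (\<lambda>_. \<one>\<^bsub>T\<^esub>) c"
    proof (rule hom_free_Abelian_group_eqI[of T _ "Lset 3"])
      show "f \<circ> bd_Q 2 \<in> hom (free_Abelian_group (Lset 3)) T"
        using hom_compose[OF bd_Q_2_hom f] by (simp add: Q_grp_simps)
      show "(\<lambda>_. \<one>\<^bsub>T\<^esub>) \<in> hom (free_Abelian_group (Lset 3)) T" by (simp add: hom_def)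
    qed (use c bd in \<open>simp_all add: Q_grp_simps\<close>)
    then show ?thesis by simp
  qed
  then have "boundaries \<subseteq> kernel (C_grp 1) T f'"
    using subgroup.subset[OF subgroup_boundaries]
    by (auto simp: kernel_def boundaries_eq f'(2) bd_Q_2_closed)
  then obtain g where g: "g \<in> hom (H_grp 1) T"
      "\<And>x. x \<in> carrier (C_grp 1) \<Longrightarrow> g (boundaries #>\<^bsub>C_grp 1\<^esub> x) = f' x"
    unfolding H_grp_1 using f'.FactGroup_universal_kernel[OF normal_boundaries] by metis
  have "M_sub 1 #>\<^bsub>Q_grp 1\<^esub> c \<in> carrier (C_grp 1)" if "c \<in> carrier (Q_grp 1)" for c :: "'a chain"
    using that by (auto simp: C_grp_def carrier_FactGroup)
  then show ?thesis using g f'(2) by (intro that[of g]) (simp_all add: hclass_def)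
qed

section \<open>The isomorphism\<close>

text \<open>The boundary of the line through \<open>(1, a, c a)\<close> is \<open>[c] - [c a] + [a]\<close> up to degenerate terms.\<close>

lemma line_hom: "(\<lambda>a. hclass (frag_of (line a))) \<in> hom (mult_group :: 'k::division_ring monoid) (H_grp 1)"
proof (rule homI)
  interpret H: comm_group "H_grp 1 :: 'k chain set set monoid" by (rule comm_group_H_grp_1)
  have L: "frag_of (line a) \<in> carrier (Q_grp 1)" for a :: 'k by (simp add: Q_grp_simps line_Lset)
  show cl: "hclass (frag_of (line a)) \<in> carrier (H_grp 1)" for a :: 'k
    using hom_in_carrier[OF hclass_hom L] .
  fix c a :: 'k
  assume "c \<in> carrier mult_group" "a \<in> carrier mult_group"
  then have ac: "a \<noteq> 0" "c \<noteq> 0" by (simp_all add: mult_group_simps)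
  obtain X :: "'k mclass" where X: "X \<in> Lset 3" "\<And>r s t. on_space X r s t \<longleftrightarrow> s = a * r \<and> t = c * s"
    using ex_space_line[of a c] by auto
  obtain m where m: "m \<in> M_sub 1"
      "bd_Q 2 (frag_of X) + frag_of (line (c * a)) = frag_of (line c) + frag_of (line a) + m"
    using bd_Q_2_of_line[OF faces_of_line[OF X(1) ac X(2)]] by blast
  have X2: "frag_of X \<in> carrier (Q_grp 2)" using X(1) by (simp add: Q_grp_simps)
  have m1: "m \<in> carrier (Q_grp 1)" using m(1) subgroup.mem_carrier[OF subgroup_M_sub] by blast
  have La: "frag_of (line c) + frag_of (line a) \<in> carrier (Q_grp 1)"
    using subgroup.m_closed[OF group.subgroup_self[OF comm_group.axioms(2)[OF comm_group_Q_grp]] L L]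
    by (simp add: Q_grp_simps)
  have "hclass (bd_Q 2 (frag_of X) + frag_of (line (c * a))) = hclass (frag_of (line (c * a)))"
    using cl by (simp add: hclass_add bd_Q_2_closed[OF X2] L hclass_bd[OF X2])
  moreover have "hclass (frag_of (line c) + frag_of (line a) + m)
      = hclass (frag_of (line c)) \<otimes>\<^bsub>H_grp 1\<^esub> hclass (frag_of (line a))"
    using cl by (simp add: hclass_add La m1 L hclass_M_sub[OF m(1)])
  ultimately show "hclass (frag_of (line (c \<otimes>\<^bsub>mult_group\<^esub> a)))
      = hclass (frag_of (line c)) \<otimes>\<^bsub>H_grp 1\<^esub> hclass (frag_of (line a))"
    by (simp add: m(2) mult_group_simps)
qed

text \<open>For \<open>a = c = 1\<close> the boundary of the plane is \<open>[-1] - [1] - [1]\<close> up to degenerate terms, and \<open>[1]\<close>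
vanishes because \<open>a \<mapsto> [a]\<close> is a homomorphism.\<close>

lemma hclass_line_minus_one: "hclass (frag_of (line (- 1 :: 'k::division_ring))) = \<one>\<^bsub>H_grp 1\<^esub>"
proof -
  interpret H: comm_group "H_grp 1 :: 'k chain set set monoid" by (rule comm_group_H_grp_1)
  have L: "frag_of (line a) \<in> carrier (Q_grp 1)" for a :: 'k by (simp add: Q_grp_simps line_Lset)
  have cl: "hclass (frag_of (line a)) \<in> carrier (H_grp 1)" for a :: 'k
    using hom_in_carrier[OF hclass_hom L] .
  have one: "hclass (frag_of (line (1 :: 'k))) = \<one>\<^bsub>H_grp 1\<^esub>"
    using hom_one[OF line_hom group_mult_group H.is_group] by (simp add: mult_group_simps)
  obtain X :: "'k mclass" where X: "X \<in> Lset 3" "\<And>r s t. on_space X r s t \<longleftrightarrow> t = 1 * (s - 1 * r)"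
    using ex_space_plane[where c = "1::'k" and a = 1] by auto
  obtain m where m: "m \<in> M_sub 1"
      "bd_Q 2 (frag_of X) + (frag_of (line 1) + frag_of (line 1)) = frag_of (line (- (1 * 1))) + m"
    using bd_Q_2_of_plane[OF faces_of_plane[OF X(1) _ _ X(2)]] by auto
  have X2: "frag_of X \<in> carrier (Q_grp 2)" using X(1) by (simp add: Q_grp_simps)
  have m1: "m \<in> carrier (Q_grp 1)" using m(1) subgroup.mem_carrier[OF subgroup_M_sub] by blast
  have La: "frag_of (line c) + frag_of (line a) \<in> carrier (Q_grp 1)" for a c :: 'k
    using subgroup.m_closed[OF group.subgroup_self[OF comm_group.axioms(2)[OF comm_group_Q_grp]] L L]
    by (simp add: Q_grp_simps)
  have "hclass (bd_Q 2 (frag_of X) + (frag_of (line 1) + frag_of (line 1))) = \<one>\<^bsub>H_grp 1\<^esub>"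
    by (simp add: hclass_add bd_Q_2_closed[OF X2] La L hclass_bd[OF X2] one)
  moreover have "hclass (frag_of (line (- (1 * 1))) + m) = hclass (frag_of (line (- 1)))"
    using cl by (simp add: hclass_add m1 L hclass_M_sub[OF m(1)])
  ultimately show ?thesis using m(2) by simp
qed

text \<open>Degenerate classes get the default value \<open>1\<close>, so that the homomorphism determined by slopes kills
them.\<close>

definition slope :: "'a::division_ring mclass \<Rightarrow> 'a" where
  "slope X = (if degenerate 1 X then 1 else THE a. X = line a)"

lemma slope_simps: "degenerate 1 X \<Longrightarrow> slope X = 1" "a \<noteq> 0 \<Longrightarrow> slope (line a) = a"
  using line_not_degenerate by (auto simp: slope_def line_inject)

lemma slope_nonzero: "X \<in> Lset 2 \<Longrightarrow> slope X \<noteq> 0"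
  by (erule plane_cases) (auto simp: slope_simps)

text \<open>The boundary of a line gives \<open>c a = c \<cdot> a\<close>, and that of a plane gives \<open>- c a = c \<cdot> a\<close>; both hold in
the abelianized unit group modulo sign.\<close>

lemma slope_class_bd:
  fixes f :: "'k::division_ring chain \<Rightarrow> 'k set set"
  assumes f: "f \<in> hom (Q_grp 1) units_mod_sign"
    and gen: "\<And>X. X \<in> Lset 2 \<Longrightarrow> f (frag_of X) = unit_class (slope X)"
    and X: "X \<in> Lset 3"
  shows "f (bd_Q 2 (frag_of X)) = \<one>\<^bsub>units_mod_sign\<^esub>"
proof -
  interpret K: comm_group "units_mod_sign :: 'k set set monoid" by (rule comm_group_units_mod_sign)
  interpret f: group_hom "Q_grp 1 :: 'k chain monoid" units_mod_sign f
    by (intro group_hom.intro group_hom_axioms.intro comm_group.axioms(2) comm_group_Q_grp comm_group_units_mod_sign f)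
  have one: "unit_class (1 :: 'k) = \<one>\<^bsub>units_mod_sign\<^esub>"
    using hom_one[OF unit_class_hom group_mult_group K.is_group] by (simp add: mult_group_simps)
  have add: "f (x + y) = f x \<otimes>\<^bsub>units_mod_sign\<^esub> f y" if "x \<in> carrier (Q_grp 1)" "y \<in> carrier (Q_grp 1)" for x y
    using f.hom_mult[OF that] by (simp add: Q_grp_simps)
  have plus: "x + y \<in> carrier (Q_grp 1)" if "x \<in> carrier (Q_grp 1)" "y \<in> carrier (Q_grp 1)" for x y :: "'k chain"
    using f.G.m_closed[OF that] by (simp add: Q_grp_simps)
  have M: "f m = \<one>\<^bsub>units_mod_sign\<^esub>" if "m \<in> M_sub 1" for m
  proof -
    have "M_sub 1 \<subseteq> kernel (Q_grp 1) units_mod_sign f"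
      unfolding M_sub_simps
      by (rule f.G.generate_subgroup_incl[OF _ f.subgroup_kernel])
        (auto simp: kernel_def gen Q_grp_simps degenerate_plane_iff[unfolded One_nat_def] slope_simps one)
    then show ?thesis using that by (auto simp: kernel_def)
  qed
  have mc: "m \<in> carrier (Q_grp 1)" if "m \<in> M_sub 1" for m :: "'k chain"
    using that subgroup.mem_carrier[OF subgroup_M_sub] by blast
  have L: "frag_of (line a) \<in> carrier (Q_grp 1)" for a :: 'k by (simp add: Q_grp_simps line_Lset)
  have fL: "f (frag_of (line a)) = unit_class a" if "a \<noteq> 0" for a
    using gen[OF line_Lset] slope_simps(2)[OF that] by simp
  have X2: "frag_of X \<in> carrier (Q_grp 2)" using X by (simp add: Q_grp_simps)
  note bd = bd_Q_2_closed[OF X2]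
  note cl = unit_class_closed f.hom_closed[OF bd]
  note fs = add plus bd L mc M fL unit_class_mult cl
  show ?thesis
    using X
  proof (cases rule: space_cases)
    case 1
    then have "frag_of X \<in> M_sub 2" unfolding M_sub_simps by (auto intro: generate.incl)
    then show ?thesis using bd_Q_2_M_sub M by blast
  next
    case (line a c)
    obtain m where m: "m \<in> M_sub 1"
        "bd_Q 2 (frag_of X) + frag_of (line (c * a)) = frag_of (line c) + frag_of (line a) + m"
      using bd_Q_2_of_line[OF line(3-6)] by blast
    have "f (bd_Q 2 (frag_of X)) \<otimes>\<^bsub>units_mod_sign\<^esub> unit_class (c * a) = unit_class (c * a)"
      using arg_cong[OF m(2), of f] line(1,2) m(1) by (simp add: fs)
    then show ?thesis using line(1,2) by (simp add: cl)
  next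
    case (plane a c)
    obtain m where m: "m \<in> M_sub 1"
        "bd_Q 2 (frag_of X) + (frag_of (line c) + frag_of (line a)) = frag_of (line (- (c * a))) + m"
      using bd_Q_2_of_plane[OF plane(3-6)] by blast
    have "unit_class (- (c * a)) = unit_class (- 1) \<otimes>\<^bsub>units_mod_sign\<^esub> unit_class (c * a)"
      using plane(1,2) unit_class_mult[of "- 1" "c * a"] by simp
    then have "unit_class (- (c * a)) = unit_class (c * a)"
      using plane(1,2) by (simp add: unit_class_minus_one cl)
    then have "f (bd_Q 2 (frag_of X)) \<otimes>\<^bsub>units_mod_sign\<^esub> unit_class (c * a) = unit_class (c * a)"
      using arg_cong[OF m(2), of f] plane(1,2) m(1) by (simp add: fs)
    then show ?thesis using plane(1,2) by (simp add: cl)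
  qed
qed

theorem corollary38:
  shows "(H_grp 1 :: 'k::division_ring chain set set monoid)
    \<cong> (abelianization (mult_group :: 'k monoid)) Mod (ab_class mult_group ` {1, -1})"
proof -
  interpret H: comm_group "H_grp 1 :: 'k chain set set monoid" by (rule comm_group_H_grp_1)
  interpret K: comm_group "units_mod_sign :: 'k set set monoid" by (rule comm_group_units_mod_sign)
  have one: "unit_class (1 :: 'k) = \<one>\<^bsub>units_mod_sign\<^esub>"
    using hom_one[OF unit_class_hom group_mult_group K.is_group] by (simp add: mult_group_simps)
  have "(\<lambda>X. unit_class (slope X)) ` Lset 2 \<subseteq> carrier (units_mod_sign :: 'k set set monoid)"
    using slope_nonzero unit_class_closed by blast
  then obtain f :: "'k chain \<Rightarrow> 'k set set" where f: "f \<in> hom (Q_grp 1) units_mod_sign"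
      "\<And>X. X \<in> Lset 2 \<Longrightarrow> f (frag_of X) = unit_class (slope X)"
    unfolding Q_grp_simps using K.free_Abelian_group_universal by metis
  have "f (frag_of X) = \<one>\<^bsub>units_mod_sign\<^esub>" if "degenerate 1 X" for X
    using f(2)[OF degenerate_plane_iff[THEN iffD1, OF that, THEN conjunct1]]
    by (simp add: slope_simps(1)[OF that] one)
  then obtain h where h: "h \<in> hom (H_grp 1) (units_mod_sign :: 'k set set monoid)"
      "\<And>c. c \<in> carrier (Q_grp 1) \<Longrightarrow> h (hclass c) = f c"
    using H_grp_1_universal[OF comm_group_units_mod_sign f(1)] slope_class_bd[OF f] by metis
  obtain g :: "'k set set \<Rightarrow> 'k chain set set" where g: "g \<in> hom units_mod_sign (H_grp 1)"
      "\<And>a. a \<noteq> 0 \<Longrightarrow> g (unit_class a) = hclass (frag_of (line a))"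
    using units_universal[OF comm_group_H_grp_1 line_hom hclass_line_minus_one] by metis
  \<comment> \<open>It suffices to compare both sides on generators: degenerate classes go to the identity, and lines
    are recovered from their slopes.\<close>
  have gf: "g (f c) = hclass c" if c: "c \<in> carrier (Q_grp 1)" for c
  proof -
    have "(g \<circ> f) c = hclass c"
    proof (rule hom_free_Abelian_group_eqI[of "H_grp 1" _ "Lset 2"])
      show "g \<circ> f \<in> hom (free_Abelian_group (Lset 2)) (H_grp 1)"
        using hom_compose[OF f(1) g(1)] by (simp add: Q_grp_simps)
      show "hclass \<in> hom (free_Abelian_group (Lset 2)) (H_grp 1 :: 'k chain set set monoid)"
        using hclass_hom by (simp add: Q_grp_simps)
      show "(g \<circ> f) (frag_of X) = hclass (frag_of X)" if X: "X \<in> Lset 2" for X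
        using X
      proof (cases rule: plane_cases)
        case 1
        have "g (unit_class 1) = \<one>\<^bsub>H_grp 1\<^esub>"
          using hom_one[OF g(1) K.is_group H.is_group] by (simp add: one)
        then show ?thesis
          using f(2)[OF X] slope_simps(1)[OF 1] hclass_M_sub[OF degenerate_in_M_sub[OF 1]] by simp
      next
        case (2 a)
        then show ?thesis using f(2)[OF X] by (simp add: slope_simps g(2))
      qed
    qed (use c in \<open>simp_all add: Q_grp_simps\<close>)
    then show ?thesis by simp
  qed
  have "group_isomorphisms (H_grp 1) units_mod_sign h g"
    unfolding group_isomorphisms_def
  proof (intro conjI h(1) g(1) ballI)
    fix x :: "'k chain set set" assume "x \<in> carrier (H_grp 1)"
    then show "g (h x) = x" by (auto simp: carrier_H_grp_1 h(2) gf)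
  next
    fix y :: "'k set set" assume "y \<in> carrier units_mod_sign"
    then obtain a where a: "a \<noteq> 0" "y = unit_class a" by (auto simp: carrier_units_mod_sign mult_group_simps)
    have "frag_of (line a) \<in> carrier (Q_grp 1)" by (simp add: Q_grp_simps line_Lset)
    then show "h (g y) = y"
      using a f(2)[OF line_Lset] by (simp add: g(2) h(2) slope_simps)
  qed
  then have "(H_grp 1 :: 'k chain set set monoid) \<cong> (units_mod_sign :: 'k set set monoid)"
    by (rule is_isoI[OF group_isomorphisms_imp_iso])
  then show ?thesis by (simp only: units_mod_sign_def signs_def)
qed

end
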